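(* For all integers $1\le d<k$, we have $$1-\sqrt{\frac{2}{(k-d)\pi}}\;\le\;\delta_d^{\mathsf{HF}}(k)\;\le\;1-\frac{1}{2(k-d)}.$$
   Context: A $k$-graph is a $k$-uniform hypergraph. The minimum $d$-degree $\delta_d(G)$ of a $k$-graph $G$ is the maximum $m$ such that every set of $d$ vertices is contained in at least $m$ edges. Connectivity. The line graph $L(G)$ of a $k$-graph $G$ is the $2$-graph with vertex set $E(G)$ and an edge $ef$ whenever $|e\cap f| = k-1$. A subgraph of $G$ is tightly connected if it has no isolated vertices and its edges induce a connected subgraph of $L(G)$. Edge-maximal tightly connected subgraphs are called tight components. Space. A fractional matching of an $n$-vertex $k$-graph $G$ is a function $\omega : E(G)\to[0,1]$ with $\sum_{e \ni v}\omega(e)\le 1$ for every vertex $v$; it is perfect if $\sum_{e}\omega(e) = n/k$. Closed walks. A $k$-uniform cycle has a cyclic ordering of its vertices such that its edges are exactly the sets of $k$ cyclically consecutive vertices. A homomorphism is a vertex map sending edges to edges. A closed walk in $G$ is the image of a homomorphism from a $k$-uniform cycle $C$ to $G$; its order is the number of vertices of $C$. Hamilton framework. A family $\mathcal{G}$ of $s$-vertex $k$-graphs has (admits) a Hamilton framework $F$ if for every $G\in\mathcal{G}$ there is an $s$-vertex subgraph $F(G)\subseteq G$ such that (F1) $F(G)$ is a tight component of $G$; (F2) $F(G)$ has a perfect fractional matching; (F3) $F(G)$ contains a closed walk of order $\equiv 1 \bmod k$; (F4) $F(G)\cup F(G')$ is tightly connected whenever $G,G'\in\mathcal{G}$ are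 obtained by deleting a distinct vertex from the same $(s+1)$-vertex $k$-graph. Threshold. $\delta_d^{\mathsf{HF}}(k)$ (short for $\delta_d^{\mathsf{HF}}(k,k)$) is the infimum of all $\delta\in[0,1]$ such that for every $\varepsilon>0$ there is $n_0$ such that, for each $n\ge n_0$, the family of all $n$-vertex $k$-graphs $G$ with $\delta_d(G)\ge(\delta+\varepsilon)\binom{n-d}{k-d}$ admits a Hamilton framework. *)

theory Defs
  imports Complex_Main "HOL-Number_Theory.Cong"
begin

datatype 'a hypergraph = Hypergraph (verts: "'a set") (edges: "'a set set")

definition kgraph :: "nat \<Rightarrow> 'a hypergraph \<Rightarrow> bool" where
  "kgraph k G \<longleftrightarrow>
     finite (verts G) \<and> (\<forall>e\<in>edges G. e \<subseteq> verts G \<and> card e = k)"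

definition subgraph :: "'a hypergraph \<Rightarrow> 'a hypergraph \<Rightarrow> bool" where
  "subgraph H G \<longleftrightarrow>
     verts H \<subseteq> verts G \<and> edges H \<subseteq> edges G \<and> (\<forall>e\<in>edges H. e \<subseteq> verts H)"

definition induced_subgraph :: "'a hypergraph \<Rightarrow> 'a set \<Rightarrow> 'a hypergraph" where
  "induced_subgraph G W = Hypergraph (verts G \<inter> W) {e \<in> edges G. e \<subseteq> W}"

definition delete_vertex :: "'a hypergraph \<Rightarrow> 'a \<Rightarrow> 'a hypergraph" where
  "delete_vertex G x = induced_subgraph G (verts G - {x})"

definition graph_union :: "'a hypergraph \<Rightarrow> 'a hypergraph \<Rightarrow> 'a hypergraph" where
  "graph_union G H = Hypergraph (verts G \<union> verts H) (edges G \<union> edges H)"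

text \<open>If there are fewer than \<open>d\<close> vertices, no maximum exists and the value is unspecified.\<close>

definition min_degree :: "nat \<Rightarrow> 'a hypergraph \<Rightarrow> nat" where
  "min_degree d G =
     (GREATEST m. \<forall>S. S \<subseteq> verts G \<and> card S = d \<longrightarrow> m \<le> card {e \<in> edges G. S \<subseteq> e})"

definition line_graph :: "nat \<Rightarrow> 'a hypergraph \<Rightarrow> 'a set hypergraph" where
  "line_graph k G =
     Hypergraph (edges G) {{e, f} | e f. e \<in> edges G \<and> f \<in> edges G \<and> card (e \<inter> f) = k - 1}"

text \<open>Ordinary graph connectivity, for a 2-graph; the graph without vertices does not count
  as connected.\<close>

definition connected_graph :: "'a hypergraph \<Rightarrow> bool" where
  "connected_graph G \<longleftrightarrow>
     verts G \<noteq> {} \<and> (\<forall>u\<in>verts G. \<forall>v\<in>verts G. (u, v) \<in> {(x, y). {x, y} \<in> edges G}\<^sup>*)"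

text \<open>\<open>H\<close> is a tightly connected subgraph of the \<open>k\<close>-graph \<open>G\<close>.\<close>

definition tightly_connected :: "nat \<Rightarrow> 'a hypergraph \<Rightarrow> 'a hypergraph \<Rightarrow> bool" where
  "tightly_connected k G H \<longleftrightarrow>
     subgraph H G \<and>
     (\<forall>v\<in>verts H. \<exists>e\<in>edges H. v \<in> e) \<and>
     connected_graph (induced_subgraph (line_graph k G) (edges H))"

definition tight_component :: "nat \<Rightarrow> 'a hypergraph \<Rightarrow> 'a hypergraph \<Rightarrow> bool" where
  "tight_component k G H \<longleftrightarrow>
     tightly_connected k G H \<and>
     (\<forall>H'. tightly_connected k G H' \<longrightarrow> \<not> edges H \<subset> edges H')"

definition fractional_matching :: "'a hypergraph \<Rightarrow> ('a set \<Rightarrow> real) \<Rightarrow> bool" where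
  "fractional_matching G \<omega> \<longleftrightarrow>
     (\<forall>e\<in>edges G. 0 \<le> \<omega> e \<and> \<omega> e \<le> 1) \<and>
     (\<forall>v\<in>verts G. (\<Sum>e\<in>{e \<in> edges G. v \<in> e}. \<omega> e) \<le> 1)"

definition perfect_fractional_matching ::
    "nat \<Rightarrow> 'a hypergraph \<Rightarrow> ('a set \<Rightarrow> real) \<Rightarrow> bool" where
  "perfect_fractional_matching k G \<omega> \<longleftrightarrow>
     fractional_matching G \<omega> \<and>
     (\<Sum>e\<in>edges G. \<omega> e) = real (card (verts G)) / real k"

text \<open>The list is the cyclic ordering of the vertices. The length bound is what makes \<open>k\<close>
  cyclically consecutive vertices distinct, so that the cycle is a \<open>k\<close>-graph.\<close>

definition kcycle :: "nat \<Rightarrow> 'a hypergraph \<Rightarrow> bool" where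
  "kcycle k C \<longleftrightarrow>
     (\<exists>xs. distinct xs \<and> k \<le> length xs \<and> verts C = set xs \<and>
        edges C = {{xs ! ((i + j) mod length xs) | j. j < k} | i. i < length xs})"

definition homomorphism :: "'a hypergraph \<Rightarrow> 'b hypergraph \<Rightarrow> ('a \<Rightarrow> 'b) \<Rightarrow> bool" where
  "homomorphism C G f \<longleftrightarrow> f ` verts C \<subseteq> verts G \<and> (\<forall>e\<in>edges C. f ` e \<in> edges G)"

text \<open>\<open>W\<close> is a closed walk of order \<open>m\<close> in \<open>G\<close>. Cycles on natural numbers represent
  all finite cycles up to isomorphism.\<close>

definition closed_walk :: "nat \<Rightarrow> 'a hypergraph \<Rightarrow> 'a hypergraph \<Rightarrow> nat \<Rightarrow> bool" where
  "closed_walk k G W m \<longleftrightarrow>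
     (\<exists>(C :: nat hypergraph) f.
        kcycle k C \<and> card (verts C) = m \<and> homomorphism C G f \<and>
        W = Hypergraph (f ` verts C) ((\<lambda>e. f ` e) ` edges C))"

text \<open>Subgraphs \<open>F G\<close> are spanning. Tight connectivity of the union \<open>F G \<union> F G'\<close> is
  understood inside the common \<open>(s + 1)\<close>-vertex host \<open>J\<close>.\<close>

definition hamilton_framework ::
    "nat \<Rightarrow> nat \<Rightarrow> 'a hypergraph set \<Rightarrow> ('a hypergraph \<Rightarrow> 'a hypergraph) \<Rightarrow> bool" where
  "hamilton_framework k s \<G> F \<longleftrightarrow>
     (\<forall>G\<in>\<G>. subgraph (F G) G \<and> card (verts (F G)) = s \<and>
        tight_component k G (F G) \<and>
        (\<exists>\<omega>. perfect_fractional_matching k (F G) \<omega>) \<and>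
        (\<exists>W m. closed_walk k (F G) W m \<and> [m = 1] (mod k))) \<and>
     (\<forall>G\<in>\<G>. \<forall>G'\<in>\<G>. \<forall>J x y.
        kgraph k J \<and> card (verts J) = s + 1 \<and>
        x \<in> verts J \<and> y \<in> verts J \<and> x \<noteq> y \<and>
        G = delete_vertex J x \<and> G' = delete_vertex J y \<longrightarrow>
        tightly_connected k J (graph_union (F G) (F G')))"

definition admits_hamilton_framework :: "nat \<Rightarrow> nat \<Rightarrow> 'a hypergraph set \<Rightarrow> bool" where
  "admits_hamilton_framework k s \<G> \<longleftrightarrow> (\<exists>F. hamilton_framework k s \<G> F)"

text \<open>All \<open>n\<close>-vertex \<open>k\<close>-graphs of relative minimum \<open>d\<close>-degree at least \<open>\<alpha>\<close>, with
  vertices drawn from the infinite universe of natural numbers.\<close>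

definition degree_family :: "nat \<Rightarrow> nat \<Rightarrow> nat \<Rightarrow> real \<Rightarrow> nat hypergraph set" where
  "degree_family d k n \<alpha> =
     {G. kgraph k G \<and> card (verts G) = n \<and>
         real (min_degree d G) \<ge> \<alpha> * real ((n - d) choose (k - d))}"

definition hf_threshold :: "nat \<Rightarrow> nat \<Rightarrow> real" where
  "hf_threshold d k =
     Inf {\<delta>. 0 \<le> \<delta> \<and> \<delta> \<le> 1 \<and>
            (\<forall>\<epsilon>>0. \<exists>n0. \<forall>n\<ge>n0. admits_hamilton_framework k n (degree_family d k n (\<delta> + \<epsilon>)))}"

end

theory Submission
  imports Defs "HOL-Combinatorics.Multiset_Permutations" "HOL-Analysis.Gamma_Function"
begin

text \<open>
  Write \<open>t = k - d\<close> and let \<open>G\<close> be a \<open>k\<close>-graph on \<open>n\<close> vertices.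

  Upper bound. Suppose that every \<open>d\<close>-set \<open>S\<close> lies in a proportion of more than \<open>1 - 1 / (2 * t)\<close>
  of the possible edges, so that its link is a \<open>t\<close>-graph of that density. In such a \<open>t\<close>-graph,
  let a random sequence of \<open>2 * t - 2\<close> vertices pass under a window of length \<open>t\<close>. By the union
  bound all \<open>t - 1\<close> windows are edges with probability at least \<open>(t + 1) / (2 * t)\<close>. Fixing the
  best choice of the first \<open>t - 1\<close> vertices, at least this proportion of all \<open>(t - 1)\<close>-sets can
  be reached from one of them along edges of the link. The edges over the reached sets form the
  giant tight component of the link; its density exceeds \<open>1 / 2\<close> since a reached set fails to
  extend with probability less than \<open>1 / (2 * t)\<close>. The whole framework comes from these components.

  \<^item> Any two of them share an edge \<open>T\<close>, being larger than half. One vertex of \<open>S\<close> can therefore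
    be replaced while \<open>T\<close> stays fixed, and all edges \<open>S \<union> T\<close> with \<open>T\<close> in the giant component of
    the link of \<open>S\<close> lie in a single tight component of \<open>G\<close> (\<open>rooted_connected\<close>). For two deleted
    vertices the same argument, applied to an \<open>S\<close> that avoids both, makes the two chosen tight
    components overlap (\<open>framework_components_overlap\<close>).
  \<^item> The giant component contains a clique on \<open>t + 1\<close> vertices (\<open>giant_clique\<close>). It serves as a
    switch: with the spare vertex an edge can be reordered arbitrarily by replacing single vertices,
    and each replacement is a walk of length \<open>k\<close>. So all ordered edges whose last \<open>t\<close> entries are
    in the giant component for the first \<open>d\<close> entries are joined by walks of length divisible by \<open>k\<close>.
    They are more than half of all ordered \<open>k\<close>-sets, hence one of them is the rotation of another
    one, and a rotation is a walk of length \<open>1\<close> (\<open>giant_closed_walk\<close>).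
  \<^item> By Farkas's lemma a perfect fractional matching exists unless some vertex weighting is
    nonnegative on all edges but has negative sum. Taking for \<open>S\<close> the \<open>d\<close> vertices of least weight
    and double counting pairs of a giant edge and one of its vertices excludes this
    (\<open>giant_expansion\<close>, \<open>giant_perfect_fractional_matching\<close>). The count needs that the reached sets
    do not outnumber the giant edges by too much, and \<open>(t + 1) / (2 * t)\<close> is just what suffices.

  Lower bound. Split \<open>2 * h\<close> vertices into two halves and take all \<open>k\<close>-sets except those with
  exactly \<open>k div 2\<close> vertices in the first half \<open>X\<close>. A \<open>d\<close>-set misses a proportion of at most about
  the largest point probability of the binomial distribution with parameters \<open>t\<close> and \<open>1 / 2\<close>, and this
  is at most \<open>sqrt (2 / (t * pi))\<close> (\<open>binomial_le_sqrt\<close>). Adjacent edges have intersections with \<open>X\<close>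
  whose sizes differ by at most one, so in a tight component these sizes are all smaller or all larger
  than \<open>k div 2\<close>. A perfect fractional matching would need them to average to \<open>k / 2\<close>, which
  is impossible (\<open>avoiding_hypergraph_no_framework\<close>).
\<close>

section \<open>Tuples and changes of a single entry\<close>

text \<open>Entries may repeat, so the number of tuples is an exact power of the number of vertices; the tuples
with repetitions count as missing in every density estimate.\<close>

definition tuples :: "'a set \<Rightarrow> nat \<Rightarrow> 'a list set" where
  "tuples V m = {xs. set xs \<subseteq> V \<and> length xs = m}"

lemma finite_tuples: "finite V \<Longrightarrow> finite (tuples V m)"
  unfolding tuples_def by (rule finite_lists_length_eq)

lemma card_tuples: "finite V \<Longrightarrow> card (tuples V m) = card V ^ m"
  unfolding tuples_def by (rule card_lists_length_eq)

text \<open>Here \<open>\<phi>\<close> reads off some of the entries of a tuple and \<open>\<psi>\<close> the remaining ones, as injectivity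
expresses. The lemma bounds the number of tuples that a bad value of \<open>\<phi>\<close> can spoil.\<close>

lemma card_tuples_preimage_le:
  assumes fin: "finite V" and B: "finite B"
    and inj: "inj_on (\<lambda>zs. (\<phi> zs, \<psi> zs)) (tuples V N)"
    and rest: "\<And>zs. zs \<in> tuples V N \<Longrightarrow> \<psi> zs \<in> tuples V M"
  shows "card {zs \<in> tuples V N. \<phi> zs \<in> B} \<le> card B * card V ^ M"
proof -
  have "card {zs \<in> tuples V N. \<phi> zs \<in> B} = card ((\<lambda>zs. (\<phi> zs, \<psi> zs)) ` {zs \<in> tuples V N. \<phi> zs \<in> B})"
    by (rule card_image [symmetric]) (rule inj_on_subset [OF inj], auto)
  also have "\<dots> \<le> card (B \<times> tuples V M)"
    using rest by (intro card_mono finite_cartesian_product B finite_tuples fin) auto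
  finally show ?thesis by (simp add: card_cartesian_product card_tuples fin)
qed

definition moves :: "('a list \<Rightarrow> bool) \<Rightarrow> ('a list \<times> 'a list) set" where
  "moves P = {(xs, ys). P xs \<and> P ys \<and> (\<exists>i w. i < length xs \<and> ys = xs[i := w])}"

lemma movesI: "P xs \<Longrightarrow> P (xs[i := w]) \<Longrightarrow> i < length xs \<Longrightarrow> (xs, xs[i := w]) \<in> moves P"
  unfolding moves_def by blast

lemma sym_moves: "sym (moves P)"
proof (rule symI)
  fix xs ys assume "(xs, ys) \<in> moves P"
  then obtain i w where "P xs" "P ys" "i < length xs" "ys = xs[i := w]"
    unfolding moves_def by blast
  then have "xs = ys[i := xs ! i]" "i < length ys" by auto
  then show "(ys, xs) \<in> moves P"
    using \<open>P xs\<close> \<open>P ys\<close> unfolding moves_def by blast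
qed

lemma sym_moves_rtrancl: "(xs, ys) \<in> (moves P)\<^sup>* \<Longrightarrow> (ys, xs) \<in> (moves P)\<^sup>*"
  using sym_rtrancl [OF sym_moves] by (rule symD)

text \<open>The entries are put right from left to right. If the wanted vertex already occurs at a later
position, that position is first given a vertex outside the list, which exists because the list
does not exhaust \<open>U\<close>. With \<open>U\<close> one vertex larger than the list, this reorders a list.\<close>

lemma distinct_tuples_connected:
  assumes fin: "finite U" and m: "length xs < card U"
    and xs: "distinct xs" "set xs \<subseteq> U"
    and ys: "distinct ys" "set ys \<subseteq> U" and len: "length ys = length xs"
  shows "(xs, ys) \<in> (moves (\<lambda>zs. distinct zs \<and> set zs \<subseteq> U))\<^sup>*"
proof -
  let ?P = "\<lambda>zs. distinct zs \<and> set zs \<subseteq> U"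
  have "\<exists>zs. ?P zs \<and> length zs = length xs \<and> take i zs = take i ys \<and> (xs, zs) \<in> (moves ?P)\<^sup>*"
    if "i \<le> length xs" for i
    using that
  proof (induction i)
    case 0
    then show ?case using xs by auto
  next
    case (Suc i)
    then obtain zs where zs: "distinct zs" "set zs \<subseteq> U" "length zs = length xs"
      "take i zs = take i ys" "(xs, zs) \<in> (moves ?P)\<^sup>*" by auto
    have i: "i < length zs" using Suc.prems zs by simp
    have yi: "ys ! i \<in> U" using ys len Suc.prems by auto
    have yi_take: "ys ! i \<notin> set (take i ys)"
      using ys(1) len Suc.prems by (auto simp: in_set_conv_nth nth_eq_iff_index_eq)
    have finish: ?case if z': "?P zs'" "length zs' = length xs" "take i zs' = take i ys"
      "(xs, zs') \<in> (moves ?P)\<^sup>*" "ys ! i \<notin> set zs'" for zs'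
    proof -
      let ?z = "zs'[i := ys ! i]"
      have P: "?P ?z" using z' yi distinct_list_update [of zs' "ys ! i" i] set_update_subset_insert [of zs' i "ys ! i"] by fast
      have "(zs', ?z) \<in> moves ?P" using z' P Suc.prems by (intro movesI) auto
      moreover have "take (Suc i) ?z = take (Suc i) ys"
        using z' Suc.prems len by (simp add: take_Suc_conv_app_nth)
      ultimately show ?thesis using z' P
        by (intro exI [of _ ?z]) (auto intro: rtrancl_into_rtrancl)
    qed
    show ?case
    proof (cases "ys ! i \<in> set zs")
      case False
      then show ?thesis using finish [of zs] zs by auto
    next
      case True
      then obtain j where j: "j < length zs" "zs ! j = ys ! i" by (auto simp: in_set_conv_nth)
      show ?thesis
      proof (cases "j = i")
        case True
        then have "take (Suc i) zs = take (Suc i) ys"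
          using zs j len Suc.prems by (simp add: take_Suc_conv_app_nth)
        then show ?thesis using zs by auto
      next
        case False
        have "\<not> j < i"
        proof
          assume "j < i"
          then have "zs ! j = take i ys ! j" by (metis nth_take zs(4))
          then show False using yi_take j \<open>j < i\<close> i len zs(3) by (metis in_set_conv_nth length_take min_less_iff_conj)
        qed
        have "card (set zs) < card U" using m zs by (simp add: distinct_card)
        then have "\<not> U \<subseteq> set zs" using card_mono [of "set zs" U] by auto
        then obtain w where w: "w \<in> U" "w \<notin> set zs" by blast
        let ?z = "zs[j := w]"
        have P: "?P ?z" using zs w distinct_list_update [of zs w j] set_update_subset_insert [of zs j w] by fast
        have "(zs, ?z) \<in> moves ?P" using zs P j by (intro movesI) auto
        moreover have "take i ?z = take i ys" using \<open>\<not> j < i\<close> zs by simp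
        moreover have "ys ! i \<notin> set ?z"
          using j zs(1) w \<open>ys ! i \<in> set zs\<close> by (auto simp: set_update_distinct)
        ultimately show ?thesis using P zs
          by (intro finish [of ?z]) (auto intro: rtrancl_into_rtrancl)
      qed
    qed
  qed
  from this [of "length xs"] show ?thesis using len by auto
qed

section \<open>The giant component of a dense uniform hypergraph\<close>

definition shadow_step :: "'a set set \<Rightarrow> nat \<Rightarrow> ('a set \<times> 'a set) set" where
  "shadow_step A r = {(R, R'). card R = r \<and> card R' = r \<and> (\<exists>T\<in>A. R \<subseteq> T \<and> R' \<subseteq> T)}"

lemma sym_shadow_step: "sym (shadow_step A r)"
  unfolding shadow_step_def sym_def by blast

text \<open>A window of length \<open>r + 1\<close> contains the \<open>r\<close>-windows at its two ends, so sliding it one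
place along the list is a step between those two \<open>r\<close>-sets.\<close>

lemma shadow_path:
  assumes card: "\<And>T. T \<in> A \<Longrightarrow> card T = Suc r"
    and windows: "\<And>i. i < m \<Longrightarrow> set (take (Suc r) (drop i zs)) \<in> A"
    and "m + r \<le> length zs" and "i \<le> m"
  shows "(set (take r zs), set (take r (drop i zs))) \<in> (shadow_step A r)\<^sup>*"
  using \<open>i \<le> m\<close>
proof (induction i)
  case 0
  show ?case by simp
next
  case (Suc i)
  define w where "w = take (Suc r) (drop i zs)"
  have len: "length w = Suc r" using assms(3) Suc.prems by (simp add: w_def)
  have wA: "set w \<in> A" using windows Suc.prems by (simp add: w_def)
  then have "distinct w" using card len by (intro card_distinct) simp
  have 1: "take r (drop i zs) = take r w" by (simp add: w_def)
  have 2: "take r (drop (Suc i) zs) = drop 1 w"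
    by (simp add: w_def drop_take)
  have "card (set (take r w)) = r" "card (set (drop 1 w)) = r"
    using \<open>distinct w\<close> len by (simp_all add: distinct_card)
  then have "(set (take r w), set (drop 1 w)) \<in> shadow_step A r"
    using wA set_take_subset [of r w] set_drop_subset [of 1 w]
    unfolding shadow_step_def by auto
  then have "(set (take r (drop i zs)), set (take r (drop (Suc i) zs))) \<in> shadow_step A r"
    unfolding 1 2 .
  with Suc.IH [OF Suc_leD [OF Suc.prems]] show ?case by (rule rtrancl_into_rtrancl)
qed

text \<open>An \<open>(r + 1)\<close>-graph of density greater than \<open>1 - 1 / (2 * (r + 1))\<close>, measured in tuples. It will be
the link of a \<open>d\<close>-set, with \<open>r + 1 = k - d\<close>.\<close>

locale dense_uniform =
  fixes V :: "'a set" and A :: "'a set set" and r :: nat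
  assumes finite_V: "finite V"
    and uniform: "T \<in> A \<Longrightarrow> T \<subseteq> V \<and> card T = Suc r"
    and dense: "2 * Suc r * card {xs \<in> tuples V (Suc r). set xs \<notin> A} < card V ^ Suc r"
begin

definition missing :: nat where
  "missing = card {xs \<in> tuples V (Suc r). set xs \<notin> A}"

lemma missing_small: "2 * Suc r * missing < card V ^ Suc r"
  using dense unfolding missing_def .

lemma card_V_pos: "0 < card V"
  using dense by (cases "card V") auto

text \<open>Each of the \<open>r\<close> windows of a \<open>2 * r\<close>-tuple is bad for at most the proportion of missing tuples,
so by the union bound most tuples have only good windows; averaging over the first \<open>r\<close> entries
gives a prefix that does at least as well.\<close>

lemma exists_dense_prefix:
  "\<exists>ps\<in>tuples V r. card V ^ Suc r \<le>
     card V * card {ys \<in> tuples V r. \<forall>i<r. set (take (Suc r) (drop i (ps @ ys))) \<in> A} + r * missing"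
proof (rule ccontr)
  define n where "n = card V"
  define bad where "bad = {xs \<in> tuples V (Suc r). set xs \<notin> A}"
  define wnd where "wnd = (\<lambda>i zs :: 'a list. take (Suc r) (drop i zs))"
  define good where "good = {zs \<in> tuples V (2 * r). \<forall>i<r. set (wnd i zs) \<in> A}"
  define g where "g = (\<lambda>ps. {ys \<in> tuples V r. \<forall>i<r. set (wnd i (ps @ ys)) \<in> A})"
  have fin [simp]: "finite (tuples V m)" for m by (rule finite_tuples [OF finite_V])
  have fbad: "finite bad" unfolding bad_def by simp
  have fg: "finite (g ps)" for ps unfolding g_def by simp
  assume "\<not> ?thesis"
  then have less: "n * card (g ps) + r * missing < n ^ Suc r" if "ps \<in> tuples V r" for ps
    using that unfolding n_def g_def wnd_def by (auto simp: not_le)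
  have bad_i: "card {zs \<in> tuples V (2 * r). wnd i zs \<in> bad} \<le> missing * n ^ (r - 1)"
    if i: "i < r" for i
    unfolding missing_def bad_def [symmetric] n_def
  proof (rule card_tuples_preimage_le [OF finite_V fbad])
    let ?\<psi> = "\<lambda>zs :: 'a list. take i zs @ drop (i + Suc r) zs"
    show "inj_on (\<lambda>zs. (wnd i zs, ?\<psi> zs)) (tuples V (2 * r))"
    proof (rule inj_on_inverseI)
      fix zs assume zs: "zs \<in> tuples V (2 * r)"
      have "take i zs @ take (Suc r) (drop i zs) @ drop (Suc r) (drop i zs) = zs"
        by (simp only: append_take_drop_id)
      moreover have "take i (?\<psi> zs) = take i zs" "drop i (?\<psi> zs) = drop (Suc r) (drop i zs)"
        using zs i by (simp_all add: tuples_def add.commute)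
      ultimately show "(\<lambda>(p, q). take i q @ p @ drop i q) (wnd i zs, ?\<psi> zs) = zs"
        by (simp only: wnd_def prod.case)
    qed
    show "?\<psi> zs \<in> tuples V (r - 1)" if "zs \<in> tuples V (2 * r)" for zs
      using that i set_take_subset [of i zs] set_drop_subset [of "i + Suc r" zs]
      by (auto simp: tuples_def)
  qed
  have "tuples V (2 * r) \<subseteq> good \<union> (\<Union>i\<in>{..<r}. {zs \<in> tuples V (2 * r). wnd i zs \<in> bad})"
  proof
    fix zs assume zs: "zs \<in> tuples V (2 * r)"
    have "wnd i zs \<in> tuples V (Suc r)" if "i < r" for i
      using that zs set_take_subset [of "Suc r" "drop i zs"] set_drop_subset [of i zs]
      by (auto simp: tuples_def wnd_def)
    then show "zs \<in> good \<union> (\<Union>i\<in>{..<r}. {zs \<in> tuples V (2 * r). wnd i zs \<in> bad})"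
      using zs unfolding good_def bad_def by blast
  qed
  then have "card (tuples V (2 * r)) \<le> card (good \<union> (\<Union>i\<in>{..<r}. {zs \<in> tuples V (2 * r). wnd i zs \<in> bad}))"
    by (intro card_mono) (auto simp: good_def)
  also have "\<dots> \<le> card good + card (\<Union>i\<in>{..<r}. {zs \<in> tuples V (2 * r). wnd i zs \<in> bad})"
    by (rule card_Un_le)
  also have "card (\<Union>i\<in>{..<r}. {zs \<in> tuples V (2 * r). wnd i zs \<in> bad})
      \<le> (\<Sum>i<r. card {zs \<in> tuples V (2 * r). wnd i zs \<in> bad})"
    by (rule card_UN_le) simp
  also have "\<dots> \<le> (\<Sum>i<r. missing * n ^ (r - 1))"
    by (rule sum_mono) (use bad_i in auto)
  finally have 1: "n ^ (2 * r) \<le> card good + r * (missing * n ^ (r - 1))"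
    by (simp add: card_tuples finite_V n_def)
  have "good \<subseteq> (\<lambda>(ps, ys). ps @ ys) ` Sigma (tuples V r) g"
  proof
    fix zs assume zs: "zs \<in> good"
    have "take r zs \<in> tuples V r" "drop r zs \<in> tuples V r"
      using zs set_take_subset [of r zs] set_drop_subset [of r zs] by (auto simp: good_def tuples_def)
    then have "(take r zs, drop r zs) \<in> Sigma (tuples V r) g"
      using zs by (simp add: g_def good_def)
    then show "zs \<in> (\<lambda>(ps, ys). ps @ ys) ` Sigma (tuples V r) g"
      by (rule rev_image_eqI) simp
  qed
  then have "card good \<le> card ((\<lambda>(ps, ys). ps @ ys) ` Sigma (tuples V r) g)"
    by (rule card_mono [rotated]) (auto simp: fg)
  also have "\<dots> \<le> card (Sigma (tuples V r) g)" by (rule card_image_le) (auto simp: fg)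
  also have "\<dots> = (\<Sum>ps\<in>tuples V r. card (g ps))" by (simp add: fg)
  finally have 2: "card good \<le> (\<Sum>ps\<in>tuples V r. card (g ps))" .
  have "0 < n" using card_V_pos unfolding n_def .
  have "tuples V r \<noteq> {}"
    using card_tuples [OF finite_V, of r] card_V_pos by (metis card.empty power_not_zero less_irrefl)
  then have "(\<Sum>ps\<in>tuples V r. n * card (g ps) + r * missing) < (\<Sum>ps\<in>tuples V r. n ^ Suc r)"
    using less by (intro sum_strict_mono) auto
  then have 3: "n * (\<Sum>ps\<in>tuples V r. card (g ps)) + n ^ r * (r * missing) < n ^ r * n ^ Suc r"
    by (simp add: sum.distrib card_tuples finite_V n_def sum_distrib_left)
  have "n * (r * (missing * n ^ (r - 1))) = n ^ r * (r * missing)"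
    by (cases r) (auto simp: algebra_simps)
  then have "n * n ^ (2 * r) \<le> n * card good + n ^ r * (r * missing)"
    using mult_le_mono2 [OF 1, of n] by (simp only: distrib_left)
  also have "\<dots> \<le> n * (\<Sum>ps\<in>tuples V r. card (g ps)) + n ^ r * (r * missing)"
    using 2 by simp
  also have "\<dots> < n ^ r * n ^ Suc r" by (rule 3)
  also have "\<dots> = n * n ^ (2 * r)" by (simp add: mult_2 power_add)
  finally show False by simp
qed

definition root :: "'a set" where
  "root = set (SOME ps. ps \<in> tuples V r \<and> card V ^ Suc r \<le>
     card V * card {ys \<in> tuples V r. \<forall>i<r. set (take (Suc r) (drop i (ps @ ys))) \<in> A} + r * missing)"

definition reached :: "'a set set" where
  "reached = (shadow_step A r)\<^sup>* `` {root}"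

text \<open>All \<open>r\<close>-subsets of such an edge are reached in turn, and every edge over a reached \<open>r\<close>-set
belongs to \<open>giant\<close>, so this is a tight component of \<open>A\<close>.\<close>

definition giant :: "'a set set" where
  "giant = {T \<in> A. \<exists>R\<in>reached. card R = r \<and> R \<subseteq> T}"

abbreviation giant_tuples :: "'a list set" where
  "giant_tuples \<equiv> {xs \<in> tuples V (Suc r). set xs \<in> giant}"

abbreviation reached_tuples :: "'a list set" where
  "reached_tuples \<equiv> {ys \<in> tuples V r. set ys \<in> reached}"

lemma reached_step: "R \<in> reached \<Longrightarrow> (R, R') \<in> shadow_step A r \<Longrightarrow> R' \<in> reached"
  unfolding reached_def Image_singleton_iff by (rule rtrancl_into_rtrancl)

lemma giantI: "T \<in> A \<Longrightarrow> R \<in> reached \<Longrightarrow> card R = r \<Longrightarrow> R \<subseteq> T \<Longrightarrow> T \<in> giant"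
  unfolding giant_def by blast

lemma giant_subset: "giant \<subseteq> A"
  unfolding giant_def by blast

lemma giant_uniform: "T \<in> giant \<Longrightarrow> T \<subseteq> V \<and> card T = Suc r"
  using giant_subset uniform by blast

lemma shadow_giant: "T \<in> giant \<Longrightarrow> R \<subseteq> T \<Longrightarrow> card R = r \<Longrightarrow> R \<in> reached"
proof -
  assume "T \<in> giant" and R: "R \<subseteq> T" "card R = r"
  then obtain R' where R': "R' \<in> reached" "card R' = r" "R' \<subseteq> T" "T \<in> A"
    unfolding giant_def by blast
  then have "(R', R) \<in> shadow_step A r" using R unfolding shadow_step_def by blast
  then show "R \<in> reached" by (rule reached_step [OF R'(1)])
qed

lemma giant_tuple_distinct: "xs \<in> giant_tuples \<Longrightarrow> distinct xs"
  using giant_uniform by (intro card_distinct) (auto simp: tuples_def)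

lemma reached_tuples_large: "card V ^ Suc r \<le> card V * card reached_tuples + r * missing"
proof -
  define P where "P = (\<lambda>ps. ps \<in> tuples V r \<and> card V ^ Suc r \<le>
     card V * card {ys \<in> tuples V r. \<forall>i<r. set (take (Suc r) (drop i (ps @ ys))) \<in> A} + r * missing)"
  have "\<exists>ps. P ps" using exists_dense_prefix unfolding P_def by blast
  then have "P (SOME ps. P ps)" by (rule someI_ex)
  moreover define ps where "ps = (SOME ps. P ps)"
  ultimately have P: "P ps" by simp
  have root: "root = set ps" unfolding root_def ps_def P_def ..
  have len: "length ps = r" using P unfolding P_def tuples_def by blast
  have "{ys \<in> tuples V r. \<forall>i<r. set (take (Suc r) (drop i (ps @ ys))) \<in> A} \<subseteq> reached_tuples"
  proof safe
    fix ys assume ys: "ys \<in> tuples V r"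
      and w: "\<forall>i<r. set (take (Suc r) (drop i (ps @ ys))) \<in> A"
    have "(set (take r (ps @ ys)), set (take r (drop r (ps @ ys)))) \<in> (shadow_step A r)\<^sup>*"
      by (rule shadow_path [where m = r]) (use uniform w ys len in \<open>auto simp: tuples_def\<close>)
    then show "set ys \<in> reached"
      using ys len unfolding reached_def root by (simp add: tuples_def)
  qed
  then have "card {ys \<in> tuples V r. \<forall>i<r. set (take (Suc r) (drop i (ps @ ys))) \<in> A} \<le> card reached_tuples"
    by (intro card_mono) (auto simp: finite_tuples finite_V)
  then have "card V * card {ys \<in> tuples V r. \<forall>i<r. set (take (Suc r) (drop i (ps @ ys))) \<in> A}
      \<le> card V * card reached_tuples" by simp
  then show ?thesis using P unfolding P_def by linarith
qed

text \<open>A reached tuple with one more entry that is not giant cannot be an edge at all, hence is missing.\<close>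

lemma giant_tuples_extend: "card V * card reached_tuples \<le> card giant_tuples + missing"
proof -
  let ?bad = "{xs \<in> tuples V (Suc r). set xs \<notin> A}"
  have "(\<lambda>(ys, v). ys @ [v]) ` (reached_tuples \<times> V) \<subseteq> giant_tuples \<union> ?bad"
  proof (rule image_subsetI)
    fix z assume "z \<in> reached_tuples \<times> V"
    then obtain ys v where z: "z = (ys, v)" and ys: "ys \<in> tuples V r" "set ys \<in> reached" and v: "v \<in> V"
      by blast
    have tup: "ys @ [v] \<in> tuples V (Suc r)" using ys v by (simp add: tuples_def)
    have "set (ys @ [v]) \<in> giant" if A: "set (ys @ [v]) \<in> A"
    proof -
      have "distinct (ys @ [v])" using A uniform ys by (intro card_distinct) (simp add: tuples_def)
      then have "card (set ys) = r" using ys by (simp add: tuples_def distinct_card)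
      then show ?thesis using giantI [OF A ys(2)] by auto
    qed
    then show "(case z of (ys, v) \<Rightarrow> ys @ [v]) \<in> giant_tuples \<union> ?bad" using tup z by auto
  qed
  then have "card ((\<lambda>(ys, v). ys @ [v]) ` (reached_tuples \<times> V)) \<le> card (giant_tuples \<union> ?bad)"
    by (intro card_mono) (auto simp: finite_tuples finite_V)
  also have "\<dots> \<le> card giant_tuples + missing"
    unfolding missing_def by (rule card_Un_le)
  also have "card ((\<lambda>(ys, v). ys @ [v]) ` (reached_tuples \<times> V)) = card (reached_tuples \<times> V)"
    by (rule card_image) (auto simp: inj_on_def)
  finally show ?thesis by (simp add: card_cartesian_product mult.commute)
qed

lemma giant_tuples_large: "card V ^ Suc r \<le> card giant_tuples + Suc r * missing"
  using reached_tuples_large giant_tuples_extend by simp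

lemma giant_connected:
  assumes T: "T \<in> giant" and T': "T' \<in> giant"
  shows "(T, T') \<in> {(T, T'). T \<in> giant \<and> T' \<in> giant \<and> (\<exists>R. card R = r \<and> R \<subseteq> T \<and> R \<subseteq> T')}\<^sup>*"
    (is "_ \<in> ?adj\<^sup>*")
proof -
  obtain R where R: "R \<in> reached" "card R = r" "R \<subseteq> T" using T unfolding giant_def by blast
  obtain R' where R': "R' \<in> reached" "card R' = r" "R' \<subseteq> T'" using T' unfolding giant_def by blast
  have "(R, root) \<in> (shadow_step A r)\<^sup>*"
    using R(1) symD [OF sym_rtrancl [OF sym_shadow_step]] unfolding reached_def by fast
  then have "(R, R') \<in> (shadow_step A r)\<^sup>*"
    using R'(1) unfolding reached_def by (auto intro: rtrancl_trans)
  then have "R' \<in> reached \<and> (\<forall>T'\<in>giant. card R' = r \<and> R' \<subseteq> T' \<longrightarrow> (T, T') \<in> ?adj\<^sup>*)"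
  proof (induction rule: rtrancl_induct)
    case base
    then show ?case using R T by blast
  next
    case (step R' R'')
    then obtain T'' where T'': "T'' \<in> A" "R' \<subseteq> T''" "R'' \<subseteq> T''" "card R' = r" "card R'' = r"
      unfolding shadow_step_def by blast
    have "T'' \<in> giant" using step T'' giantI by blast
    then have *: "(T, T'') \<in> ?adj\<^sup>*" using step T'' by blast
    have "(T, T') \<in> ?adj\<^sup>*" if "T' \<in> giant" "R'' \<subseteq> T'" for T'
    proof -
      have "(T'', T') \<in> ?adj" using \<open>T'' \<in> giant\<close> that T'' by blast
      with * show ?thesis by (rule rtrancl_into_rtrancl)
    qed
    moreover have "R'' \<in> reached" using step reached_step by blast
    ultimately show ?case by blast
  qed
  then show ?thesis using T' R' by blast
qed

text \<open>Consider a random \<open>(r + 2)\<close>-tuple and let \<open>\<mu>\<close> be the proportion of missing \<open>(r + 1)\<close>-tuples. The first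
\<open>r + 1\<close> entries fail to form a giant edge with probability at most \<open>(r + 1) * \<mu>\<close>. For each of them,
exchanging it for the last entry fails to give an edge with probability at most \<open>\<mu>\<close>. These bounds add up
to less than \<open>1\<close>. For \<open>r = 0\<close> the two entries could coincide.\<close>

lemma giant_clique:
  assumes "0 < r"
  obtains U where "U \<subseteq> V" "card U = r + 2" "\<And>T. T \<subseteq> U \<Longrightarrow> card T = Suc r \<Longrightarrow> T \<in> giant"
proof -
  define n where "n = card V"
  define bad where "bad = {xs \<in> tuples V (Suc r). set xs \<notin> A}"
  define N where "N = Suc (Suc r)"
  have fin [simp]: "finite (tuples V m)" for m by (rule finite_tuples [OF finite_V])
  define swap where "swap = (\<lambda>l us :: 'a list. (butlast us)[l := last us])"
  have us_eq: "butlast us @ [last us] = us" "length (butlast us) = Suc r" "butlast us \<in> tuples V (Suc r)"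
    "last us \<in> V" if "us \<in> tuples V N" for us
  proof -
    have "us \<noteq> []" using that by (auto simp: tuples_def N_def)
    then show "butlast us @ [last us] = us" by simp
    show "length (butlast us) = Suc r" using that by (auto simp: tuples_def N_def)
    then show "butlast us \<in> tuples V (Suc r)"
      using that in_set_butlastD [of _ us] by (auto simp: tuples_def)
    show "last us \<in> V" using \<open>us \<noteq> []\<close> that last_in_set by (auto simp: tuples_def)
  qed
  have 1: "card {us \<in> tuples V N. butlast us \<in> tuples V (Suc r) - giant_tuples}
      \<le> card (tuples V (Suc r) - giant_tuples) * n ^ 1"
    unfolding n_def
  proof (rule card_tuples_preimage_le [OF finite_V, where \<psi> = "\<lambda>us. [last us]"])
    show "inj_on (\<lambda>us. (butlast us, [last us])) (tuples V N)"
      by (rule inj_on_inverseI [where g = "\<lambda>(p, q). p @ q"]) (use us_eq(1) in simp)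
    show "[last us] \<in> tuples V 1" if "us \<in> tuples V N" for us
      using us_eq(4) [OF that] by (simp add: tuples_def)
  qed simp
  have "card (tuples V (Suc r) - giant_tuples) = n ^ Suc r - card giant_tuples"
    by (subst card_Diff_subset) (auto simp: card_tuples finite_V n_def)
  also have "\<dots> \<le> Suc r * missing" using giant_tuples_large unfolding n_def by simp
  finally have "card (tuples V (Suc r) - giant_tuples) * n ^ 1 \<le> Suc r * missing * n" by simp
  with 1 have 1: "card {us \<in> tuples V N. butlast us \<in> tuples V (Suc r) - giant_tuples}
      \<le> Suc r * missing * n" by (rule order_trans)
  have 2: "card {us \<in> tuples V N. swap l us \<in> bad} \<le> missing * n ^ 1" if l: "l < Suc r" for l
    unfolding n_def missing_def bad_def [symmetric]
  proof (rule card_tuples_preimage_le [OF finite_V, where \<psi> = "\<lambda>us. [us ! l]"])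
    show "finite bad" by (simp add: bad_def)
    show "inj_on (\<lambda>us. (swap l us, [us ! l])) (tuples V N)"
    proof (rule inj_on_inverseI [where g = "\<lambda>(p, q). p[l := hd q] @ [p ! l]"])
      fix us assume us: "us \<in> tuples V N"
      have "us ! l = butlast us ! l" using us_eq(2) [OF us] l by (simp add: nth_butlast)
      then show "(case (swap l us, [us ! l]) of (p, q) \<Rightarrow> p[l := hd q] @ [p ! l]) = us"
        using us_eq(1,2) [OF us] l by (simp add: swap_def)
    qed
    show "[us ! l] \<in> tuples V 1" if "us \<in> tuples V N" for us
      using that l by (auto simp: tuples_def N_def subset_iff)
  qed
  define good where "good = {us \<in> tuples V N. set (butlast us) \<in> giant \<and> (\<forall>l<Suc r. set (swap l us) \<in> A)}"
  have "tuples V N \<subseteq> good \<union> ({us \<in> tuples V N. butlast us \<in> tuples V (Suc r) - giant_tuples}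
      \<union> (\<Union>l\<in>{..<Suc r}. {us \<in> tuples V N. swap l us \<in> bad}))"
  proof
    fix us assume us: "us \<in> tuples V N"
    have "swap l us \<in> tuples V (Suc r)" for l
      using us_eq(3,4) [OF us] set_update_subset_insert [of "butlast us" l "last us"]
      by (auto simp: tuples_def swap_def)
    then show "us \<in> good \<union> ({us \<in> tuples V N. butlast us \<in> tuples V (Suc r) - giant_tuples}
      \<union> (\<Union>l\<in>{..<Suc r}. {us \<in> tuples V N. swap l us \<in> bad}))"
      using us us_eq(3) [OF us] unfolding good_def bad_def by blast
  qed
  then have "card (tuples V N) \<le> card (good \<union> ({us \<in> tuples V N. butlast us \<in> tuples V (Suc r) - giant_tuples}
      \<union> (\<Union>l\<in>{..<Suc r}. {us \<in> tuples V N. swap l us \<in> bad})))"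
    by (intro card_mono) (auto simp: good_def)
  also have "\<dots> \<le> card good + (card {us \<in> tuples V N. butlast us \<in> tuples V (Suc r) - giant_tuples}
      + card (\<Union>l\<in>{..<Suc r}. {us \<in> tuples V N. swap l us \<in> bad}))"
    by (intro order_trans [OF card_Un_le] add_left_mono card_Un_le)
  also have "card (\<Union>l\<in>{..<Suc r}. {us \<in> tuples V N. swap l us \<in> bad})
      \<le> (\<Sum>l<Suc r. card {us \<in> tuples V N. swap l us \<in> bad})"
    by (rule card_UN_le) simp
  also have "\<dots> \<le> (\<Sum>l<Suc r. missing * n ^ 1)"
    by (rule sum_mono) (use 2 in auto)
  also have "\<dots> = Suc r * missing * n" by (simp add: algebra_simps)
  finally have "n ^ N \<le> card good + (Suc r * missing * n + Suc r * missing * n)"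
    using 1 by (simp add: card_tuples finite_V n_def)
  moreover have "2 * Suc r * missing * n < n ^ Suc r * n"
    using missing_small card_V_pos unfolding n_def by (intro mult_strict_right_mono)
  ultimately have "0 < card good" by (simp add: N_def algebra_simps)
  then obtain us where "us \<in> good" by (metis card.empty ex_in_conv less_irrefl)
  define xs v where "xs = butlast us" and "v = last us"
  have us: "us \<in> tuples V N" and xs: "set xs \<in> giant" and swaps: "\<And>l. l < Suc r \<Longrightarrow> set (xs[l := v]) \<in> A"
    using \<open>us \<in> good\<close> unfolding good_def xs_def v_def swap_def by auto
  have len: "length xs = Suc r" and xsV: "set xs \<subseteq> V" and v: "v \<in> V"
    using us_eq [OF us] unfolding xs_def v_def by (auto simp: tuples_def)
  have dist: "distinct xs" using giant_uniform [OF xs] len by (intro card_distinct) simp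
  have upd: "set (xs[l := v]) = insert v (set xs - {xs ! l})" if "l < Suc r" for l
    using set_update_distinct [OF dist] len that by simp
  have vxs: "v \<notin> set xs"
  proof
    assume "v \<in> set xs"
    then obtain i where i: "i < Suc r" "xs ! i = v" using len by (auto simp: in_set_conv_nth)
    obtain l where l: "l < Suc r" "l \<noteq> i" using assms by (metis less_Suc_eq_0_disj less_not_refl)
    have "xs ! l \<noteq> v" using i l dist len by (auto simp: nth_eq_iff_index_eq)
    then have "set (xs[l := v]) = set xs - {xs ! l}" using upd [OF l(1)] \<open>v \<in> set xs\<close> by auto
    moreover have "card (set xs - {xs ! l}) = r"
      using l len dist by (simp add: card_Diff_singleton distinct_card)
    ultimately show False using uniform [OF swaps [OF l(1)]] by simp
  qed
  show ?thesis
  proof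
    show "insert v (set xs) \<subseteq> V" using v xsV by simp
    show "card (insert v (set xs)) = r + 2" using vxs dist len by (simp add: distinct_card)
    fix T assume T: "T \<subseteq> insert v (set xs)" "card T = Suc r"
    show "T \<in> giant"
    proof (cases "v \<in> T")
      case False
      then have "T \<subseteq> set xs" using T by blast
      then have "T = set xs" using T len dist by (intro card_subset_eq) (auto simp: distinct_card)
      then show ?thesis using xs by simp
    next
      case True
      then have "card (T - {v}) = r" using T finite_subset [OF T(1)] by simp
      then have "set xs - (T - {v}) \<noteq> {}" using dist len
        by (metis card_mono diff_is_0_eq' Diff_eq_empty_iff distinct_card lessI not_less List.finite_set T(1) finite_Diff finite_insert finite_subset)
      then obtain u where u: "u \<in> set xs" "u \<notin> T" using vxs by auto
      then obtain l where l: "l < Suc r" "xs ! l = u" using len by (auto simp: in_set_conv_nth)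
      have sub: "T - {v} \<subseteq> set xs - {u}" using T u by auto
      have "card (set xs - {u}) = r" using u dist len by (simp add: card_Diff_singleton distinct_card)
      then have eq: "T - {v} = set xs - {u}"
        using \<open>card (T - {v}) = r\<close> sub by (intro card_subset_eq) auto
      then have "T = set (xs[l := v])" using upd [OF l(1)] l True by auto
      then have "T \<in> A" using swaps [OF l(1)] by simp
      moreover have "T - {v} \<in> reached"
        using shadow_giant [OF xs, of "T - {v}"] eq \<open>card (T - {v}) = r\<close> by auto
      ultimately show ?thesis using giantI [of T "T - {v}"] \<open>card (T - {v}) = r\<close> by auto
    qed
  qed
qed

text \<open>This says, by linear programming duality, that the giant edges have a fractional matching of size
\<open>n / (r + 2)\<close>. Summing the weights over all giant tuples gives at least \<open>\<beta>\<close> per tuple. On the other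
hand a giant edge with a marked vertex is determined by that vertex and the reached set left after
its removal, so the sum is at most \<open>r + 1\<close> times the number of reached tuples times the total weight.
Finally \<open>(r + 1) * n * reached \<le> (r + 2) * giant\<close>, where density greater than \<open>1 - 1 / (2 * (r + 1))\<close>
is exactly what is required.\<close>

lemma giant_expansion:
  fixes w :: "'a \<Rightarrow> real"
  assumes w: "\<And>v. v \<in> V \<Longrightarrow> 0 \<le> w v" and \<beta>: "\<And>T. T \<in> giant \<Longrightarrow> \<beta> \<le> sum w T"
  shows "\<beta> * card V \<le> real (r + 2) * sum w V"
proof (cases "\<beta> \<le> 0")
  case True
  then have "\<beta> * card V \<le> 0" by (simp add: mult_nonpos_nonneg)
  also have "0 \<le> real (r + 2) * sum w V" using w by (simp add: sum_nonneg)
  finally show ?thesis .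
next
  case False
  define q where "q = card reached_tuples"
  have fin: "finite (tuples V m)" for m by (rule finite_tuples [OF finite_V])
  have pos: "(\<Sum>xs\<in>giant_tuples. w (xs ! i)) \<le> real q * sum w V" if i: "i < Suc r" for i
  proof -
    let ?f = "\<lambda>xs :: 'a list. (take i xs @ drop (Suc i) xs, xs ! i)"
    have inj: "inj_on ?f giant_tuples"
    proof (rule inj_on_inverseI [where g = "\<lambda>(p, v). take i p @ v # drop i p"])
      fix xs assume "xs \<in> giant_tuples"
      then have "length xs = Suc r" by (simp add: tuples_def)
      then show "(case ?f xs of (p, v) \<Rightarrow> take i p @ v # drop i p) = xs"
        using i by (simp add: id_take_nth_drop [symmetric])
    qed
    have "?f ` giant_tuples \<subseteq> reached_tuples \<times> V"
    proof (rule image_subsetI)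
      fix xs assume xs: "xs \<in> giant_tuples"
      then have len: "length xs = Suc r" and V: "set xs \<subseteq> V" and g: "set xs \<in> giant"
        by (auto simp: tuples_def)
      let ?p = "take i xs @ drop (Suc i) xs"
      have sub: "set ?p \<subseteq> set xs" using set_take_subset set_drop_subset by fastforce
      have "distinct (take i xs @ xs ! i # drop (Suc i) xs)"
        using giant_tuple_distinct [OF xs] len i by (simp add: id_take_nth_drop [symmetric])
      then have "distinct ?p" by auto
      moreover have lp: "length ?p = r" using len i by simp
      ultimately have "card (set ?p) = r" by (metis distinct_card)
      then have "set ?p \<in> reached" using shadow_giant [OF g sub] by simp
      then show "?f xs \<in> reached_tuples \<times> V"
        using sub V lp len i by (auto simp: tuples_def)
    qed
    then have "sum (w \<circ> snd) (?f ` giant_tuples) \<le> sum (w \<circ> snd) (reached_tuples \<times> V)"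
      using w by (intro sum_mono2) (auto simp: fin finite_V)
    also have "sum (w \<circ> snd) (reached_tuples \<times> V) = real q * sum w V"
      by (simp add: sum.cartesian_product' q_def)
    also have "sum (w \<circ> snd) (?f ` giant_tuples) = (\<Sum>xs\<in>giant_tuples. w (xs ! i))"
      using inj by (simp add: sum.reindex)
    finally show ?thesis .
  qed
  have "\<beta> * card giant_tuples = (\<Sum>xs\<in>giant_tuples. \<beta>)" by simp
  also have "\<dots> \<le> (\<Sum>xs\<in>giant_tuples. \<Sum>i<Suc r. w (xs ! i))"
  proof (rule sum_mono)
    fix xs assume xs: "xs \<in> giant_tuples"
    have "(\<Sum>i<Suc r. w (xs ! i)) = sum_list (map w xs)"
      using xs by (simp add: tuples_def sum_list_sum_nth atLeast0LessThan)
    also have "\<dots> = sum w (set xs)"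
      using giant_tuple_distinct [OF xs] by (simp add: sum_list_distinct_conv_sum_set)
    finally show "\<beta> \<le> (\<Sum>i<Suc r. w (xs ! i))" using \<beta> xs by simp
  qed
  also have "\<dots> = (\<Sum>i<Suc r. \<Sum>xs\<in>giant_tuples. w (xs ! i))" by (rule sum.swap)
  also have "\<dots> \<le> (\<Sum>i<Suc r. real q * sum w V)" by (rule sum_mono) (use pos in auto)
  finally have 1: "\<beta> * card giant_tuples \<le> real (Suc r) * (real q * sum w V)" by simp
  have "Suc r * (card V * q) \<le> (r + 2) * card giant_tuples"
    using reached_tuples_large giant_tuples_extend missing_small unfolding q_def [symmetric]
  proof -
    assume a: "card V ^ Suc r \<le> card V * q + r * missing"
      and b: "card V * q \<le> card giant_tuples + missing" and c: "2 * Suc r * missing < card V ^ Suc r"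
    have "(r + 2) * missing \<le> card V * q" using a c by simp
    moreover have "(r + 2) * (card V * q) \<le> (r + 2) * card giant_tuples + (r + 2) * missing"
      using mult_le_mono2 [OF b, of "r + 2"] by (simp add: algebra_simps)
    ultimately show ?thesis by simp
  qed
  then have 2: "real (Suc r) * (card V * real q) \<le> real (r + 2) * card giant_tuples"
    by (simp only: of_nat_mult [symmetric] of_nat_le_iff)
  have "q \<noteq> 0"
  proof
    assume "q = 0"
    then have "card V ^ Suc r \<le> r * missing" using reached_tuples_large by (simp add: q_def)
    also have "\<dots> \<le> 2 * Suc r * missing" by (rule mult_le_mono1) simp
    finally show False using missing_small by simp
  qed
  have "(real (Suc r) * real q) * (\<beta> * card V) = \<beta> * (real (Suc r) * (card V * real q))"
    by (simp only: ac_simps)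
  also have "\<dots> \<le> \<beta> * (real (r + 2) * card giant_tuples)"
    using False 2 by (intro mult_left_mono) auto
  also have "\<dots> = real (r + 2) * (\<beta> * card giant_tuples)" by (simp only: ac_simps)
  also have "\<dots> \<le> real (r + 2) * (real (Suc r) * (real q * sum w V))"
    using 1 by (intro mult_left_mono) auto
  also have "\<dots> = (real (Suc r) * real q) * (real (r + 2) * sum w V)" by (simp only: ac_simps)
  finally have "(real (Suc r) * real q) * (\<beta> * card V) \<le> (real (Suc r) * real q) * (real (r + 2) * sum w V)" .
  moreover have "0 < real (Suc r) * real q" using \<open>q \<noteq> 0\<close> by simp
  ultimately show ?thesis by (simp only: mult_le_cancel_left_pos)
qed

end

section \<open>Closed walks from single-vertex replacements\<close>

lemma moves_append:
  assumes "(xs, ys) \<in> (moves Q)\<^sup>*" and "Q xs"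
    and PQ: "\<And>zs. Q zs \<Longrightarrow> length zs = length xs \<Longrightarrow> P (ss @ zs)"
  shows "(ss @ xs, ss @ ys) \<in> (moves P)\<^sup>*"
proof -
  have "(ss @ xs, ss @ ys) \<in> (moves P)\<^sup>* \<and> length ys = length xs"
    using assms(1)
  proof (induction rule: rtrancl_induct)
    case base
    show ?case by simp
  next
    case (step ys zs)
    then obtain i w where *: "Q ys" "Q zs" "i < length ys" "zs = ys[i := w]"
      unfolding moves_def by blast
    then have "(ss @ ys, (ss @ ys)[length ss + i := w]) \<in> moves P"
      using PQ step by (intro movesI) (auto simp: list_update_append)
    then have "(ss @ ys, ss @ zs) \<in> moves P" using * by (simp add: list_update_append)
    moreover have "(ss @ xs, ss @ ys) \<in> (moves P)\<^sup>*" using step.IH ..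
    ultimately have "(ss @ xs, ss @ zs) \<in> (moves P)\<^sup>*" by (rule rtrancl_into_rtrancl [rotated])
    then show ?case using step * by simp
  qed
  then show ?thesis ..
qed

text \<open>One step along a tight walk, recorded by the window of the last vertices seen.\<close>

definition slides :: "('a list \<Rightarrow> bool) \<Rightarrow> ('a list \<times> 'a list) set" where
  "slides P = {(xs, ys). P xs \<and> P ys \<and> (\<exists>w. ys = tl xs @ [w])}"

abbreviation ordered_edge :: "nat \<Rightarrow> 'a set set \<Rightarrow> 'a list \<Rightarrow> bool" where
  "ordered_edge k E zs \<equiv> length zs = k \<and> set zs \<in> E"

text \<open>Walk through the entries of \<open>ys\<close> after those of \<open>xs\<close>. The lists differ in entry \<open>i\<close> only, so
a window that has passed it contains the vertices of \<open>ys\<close>, and an earlier one those of \<open>xs\<close>.\<close>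

lemma moves_imp_slides:
  assumes "(xs, ys) \<in> moves (ordered_edge k E)"
  shows "(xs, ys) \<in> slides (ordered_edge k E) ^^ k"
proof -
  obtain i w where xs: "length xs = k" "set xs \<in> E" and ys: "set ys \<in> E"
    and i: "i < k" and ys_eq: "ys = xs[i := w]"
    using assms unfolding moves_def by auto
  have len: "length ys = k" using ys_eq xs by simp
  define z where "z = (\<lambda>j. drop j xs @ take j ys)"
  have z_edge: "ordered_edge k E (z j)" if "j \<le> k" for j
  proof (cases "j \<le> i")
    case True
    then have "z j = drop j xs @ take j xs" using ys_eq by (simp add: z_def)
    then have "set (z j) = set xs"
      by (metis append_take_drop_id set_append Un_commute)
    then show ?thesis using xs that len by (simp add: z_def)
  next
    case False
    then have "z j = drop j ys @ take j ys" using ys_eq by (simp add: z_def)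
    then have "set (z j) = set ys"
      by (metis append_take_drop_id set_append Un_commute)
    then show ?thesis using ys xs that len by (simp add: z_def)
  qed
  have "(xs, z j) \<in> slides (ordered_edge k E) ^^ j" if "j \<le> k" for j
    using that
  proof (induction j)
    case 0
    then show ?case by (simp add: z_def)
  next
    case (Suc j)
    have "z (Suc j) = tl (z j) @ [ys ! j]"
      using Suc.prems xs len
      by (simp add: z_def take_Suc_conv_app_nth drop_Suc tl_drop tl_append2)
    then have "(z j, z (Suc j)) \<in> slides (ordered_edge k E)"
      using z_edge [of j] z_edge [of "Suc j"] Suc.prems unfolding slides_def by auto
    then show ?case using Suc by auto
  qed
  from this [of k] show ?thesis using xs len by (simp add: z_def)
qed

lemma moves_rtrancl_imp_slides:
  assumes "(xs, ys) \<in> (moves (ordered_edge k E))\<^sup>*"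
  shows "\<exists>m. (xs, ys) \<in> slides (ordered_edge k E) ^^ (k * m)"
  using assms
proof (induction rule: rtrancl_induct)
  case base
  show ?case by (rule exI [of _ 0]) simp
next
  case (step ys zs)
  then obtain m where "(xs, ys) \<in> slides (ordered_edge k E) ^^ (k * m)" by blast
  then have "(xs, zs) \<in> slides (ordered_edge k E) ^^ (k * m + k)"
    using moves_imp_slides [OF step(2)] by (auto simp: relpow_add)
  then show ?case by (intro exI [of _ "Suc m"]) (simp add: add.commute)
qed

text \<open>The first entries of the successive windows, read cyclically, form the walk: entry \<open>j\<close> of
window \<open>i\<close> is the first entry of window \<open>i + j\<close>.\<close>

lemma closed_walk_of_slides:
  assumes walk: "(zs, zs) \<in> slides (ordered_edge k (edges H)) ^^ m"
    and k: "0 < k" "k \<le> m" and sub: "\<And>e. e \<in> edges H \<Longrightarrow> e \<subseteq> verts H"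
  shows "\<exists>W. closed_walk k H W m"
proof -
  obtain s0 where s0: "s0 0 = zs" "s0 m = zs"
    "\<And>i. i < m \<Longrightarrow> (s0 i, s0 (Suc i)) \<in> slides (ordered_edge k (edges H))"
    using walk unfolding relpow_fun_conv by blast
  define s where "s = (\<lambda>i. s0 (i mod m))"
  have m: "0 < m" using k by simp
  have step: "(s i, s (Suc i)) \<in> slides (ordered_edge k (edges H))" for i
  proof -
    have "s (Suc i) = s0 (Suc (i mod m))" using s0(1,2) by (simp add: s_def mod_Suc)
    then show ?thesis using s0(3) [of "i mod m"] m by (simp add: s_def)
  qed
  have edge: "length (s i) = k" "set (s i) \<in> edges H" for i
    using step [of i] unfolding slides_def by auto
  have nth: "s i ! j = hd (s (i + j))" if "j < k" for i j
    using that
  proof (induction j arbitrary: i)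
    case 0
    then show ?case using edge [of i] by (metis add.right_neutral hd_conv_nth list.size(3) less_irrefl)
  next
    case (Suc j)
    obtain w where "s (Suc i) = tl (s i) @ [w]" using step [of i] unfolding slides_def by blast
    then have "s (Suc i) ! j = s i ! Suc j"
      using Suc.prems edge(1) [of i] by (auto simp: nth_append nth_tl)
    then show ?case using Suc by simp
  qed
  define C where "C = Hypergraph {..<m} {{(i + j) mod m | j. j < k} | i. i < m}"
  define f where "f = (\<lambda>i. hd (s i))"
  have f_mod: "f (i mod m) = f i" for i by (simp add: f_def s_def)
  have f_edge: "f ` {(i + j) mod m | j. j < k} = set (s i)" for i
  proof -
    have "f ` {(i + j) mod m | j. j < k} = (\<lambda>j. f ((i + j) mod m)) ` {..<k}" by blast
    also have "\<dots> = (\<lambda>j. s i ! j) ` {..<k}"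
      using nth f_mod by (intro image_cong) (auto simp: f_def)
    also have "\<dots> = set (s i)" using edge(1) [of i] by (auto simp: set_conv_nth)
    finally show ?thesis .
  qed
  have "kcycle k C"
    unfolding kcycle_def
  proof (intro exI [of _ "[0..<m]"] conjI)
    show "edges C = {{[0..<m] ! ((i + j) mod length [0..<m]) |j. j < k} |i. i < length [0..<m]}"
      using m by (simp add: C_def)
  qed (use k in \<open>auto simp: C_def\<close>)
  moreover have "card (verts C) = m" by (simp add: C_def)
  moreover have "homomorphism C H f"
    unfolding homomorphism_def
  proof
    have "f i \<in> verts H" for i
    proof -
      have "s i \<noteq> []" using edge(1) [of i] k by auto
      then show ?thesis using edge(2) [of i] sub unfolding f_def by (meson hd_in_set subsetD)
    qed
    then show "f ` verts C \<subseteq> verts H" by blast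
    show "\<forall>e\<in>edges C. f ` e \<in> edges H"
    proof
      fix e assume "e \<in> edges C"
      then obtain i where "e = {(i + j) mod m | j. j < k}" by (auto simp: C_def)
      then show "f ` e \<in> edges H" using f_edge edge(2) by simp
    qed
  qed
  ultimately show ?thesis unfolding closed_walk_def by blast
qed

section \<open>Perfect fractional matchings by duality\<close>

definition linear_on_functions :: "(('v \<Rightarrow> real) \<Rightarrow> real) \<Rightarrow> bool" where
  "linear_on_functions f \<longleftrightarrow> (\<forall>a b x y. f (\<lambda>v. a * x v + b * y v) = a * f x + b * f y)"

lemma linear_on_functionsD:
  "linear_on_functions f \<Longrightarrow> f (\<lambda>v. a * x v + b * y v) = a * f x + b * f y"
  unfolding linear_on_functions_def by blast

text \<open>Bartl's induction on the number of functionals. If \<open>g\<close> is not yet controlled by the functionals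
in \<open>I\<close>, some \<open>x0\<close> satisfies their inequalities and has \<open>0 < g x0\<close>; then \<open>0 < f j x0\<close>.
Projecting along \<open>x0\<close> onto the kernel of \<open>f j\<close> turns the inequality for \<open>j\<close> into \<open>0 \<le> 0\<close>, so
the induction hypothesis applies to the projected functionals. The coefficient of \<open>f j\<close> is what
the projection takes away, and it is nonnegative by the choice of \<open>x0\<close>.\<close>

lemma farkas:
  assumes "finite I" and "\<And>i. i \<in> I \<Longrightarrow> linear_on_functions (f i)" and "linear_on_functions g"
    and "\<And>x. (\<And>i. i \<in> I \<Longrightarrow> f i x \<le> 0) \<Longrightarrow> g x \<le> 0"
  shows "\<exists>u. (\<forall>i\<in>I. 0 \<le> u i) \<and> (\<forall>x. g x = (\<Sum>i\<in>I. u i * f i x))"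
  using assms
proof (induction I arbitrary: f g rule: finite_induct)
  case empty
  have "g x = 0" for x
  proof -
    have "g (\<lambda>v. (-1) * x v + 0 * x v) = - g x"
      using linear_on_functionsD [OF empty(2), of "-1" x 0 x] by simp
    moreover have "g (\<lambda>v. (-1) * x v + 0 * x v) \<le> 0" "g x \<le> 0" using empty(3) by auto
    ultimately show ?thesis by simp
  qed
  then show ?case by simp
next
  case (insert j I)
  show ?case
  proof (cases "\<forall>x. (\<forall>i\<in>I. f i x \<le> 0) \<longrightarrow> g x \<le> 0")
    case True
    then obtain u where u: "\<forall>i\<in>I. 0 \<le> u i" "\<And>x. g x = (\<Sum>i\<in>I. u i * f i x)"
      using insert.IH [of f g] insert.prems by auto
    have "(\<Sum>i\<in>insert j I. (u(j := 0)) i * f i x) = (\<Sum>i\<in>I. u i * f i x)" for x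
      using insert.hyps by (simp add: sum.insert) (rule sum.cong, auto)
    then show ?thesis using u by (intro exI [of _ "u(j := 0)"]) auto
  next
    case False
    then obtain x0 where x0: "\<And>i. i \<in> I \<Longrightarrow> f i x0 \<le> 0" "0 < g x0" by (auto simp: not_le)
    have pos: "0 < f j x0"
    proof (rule ccontr)
      assume "\<not> 0 < f j x0"
      then have "g x0 \<le> 0" using x0(1) insert.prems(3) by (metis insertE not_less)
      then show False using x0(2) by simp
    qed
    define z where "z = (\<lambda>v. (1 / f j x0) * x0 v + 0 * x0 v)"
    have z: "h z = h x0 / f j x0" if "linear_on_functions h" for h
      using linear_on_functionsD [OF that, of "1 / f j x0" x0 0 x0] by (simp add: z_def)
    define p where "p = (\<lambda>x v. 1 * x v + (- f j x) * z v)"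
    have p: "h (p x) = h x - f j x * h z" if "linear_on_functions h" for h x
      using linear_on_functionsD [OF that, of 1 x "- f j x" z] by (simp add: p_def)
    have lin: "linear_on_functions (\<lambda>x. h (p x))" if h: "linear_on_functions h" for h
      unfolding p [OF h] using linear_on_functionsD [OF h] linear_on_functionsD [of "f j"] insert.prems(1)
      by (simp add: linear_on_functions_def algebra_simps)
    have fj: "f j z = 1" "f j (p x) = 0" for x
      using z [of "f j"] p [of "f j" x] insert.prems(1) pos by auto
    have "\<exists>u. (\<forall>i\<in>I. 0 \<le> u i) \<and> (\<forall>x. g (p x) = (\<Sum>i\<in>I. u i * f i (p x)))"
    proof (rule insert.IH)
      show "linear_on_functions (\<lambda>x. f i (p x))" if "i \<in> I" for i
        using that insert.prems(1) by (intro lin) auto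
      show "linear_on_functions (\<lambda>x. g (p x))" by (rule lin [OF insert.prems(2)])
      show "g (p x) \<le> 0" if "\<And>i. i \<in> I \<Longrightarrow> f i (p x) \<le> 0" for x
        using that fj(2) by (intro insert.prems(3)) auto
    qed
    then obtain u where u: "\<And>i. i \<in> I \<Longrightarrow> 0 \<le> u i" "\<And>x. g (p x) = (\<Sum>i\<in>I. u i * f i (p x))" by blast
    \<comment> \<open>This will be the coefficient of \<open>f j\<close>.\<close>
    define c where "c = g z - (\<Sum>i\<in>I. u i * f i z)"
    have gz: "0 < g z" using z [OF insert.prems(2)] x0(2) pos by simp
    have "(\<Sum>i\<in>I. u i * f i z) \<le> 0"
    proof (rule sum_nonpos)
      fix i assume i: "i \<in> I"
      have "f i z \<le> 0" using z [of "f i"] insert.prems(1) x0(1) i pos by (simp add: divide_le_0_iff)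
      then show "u i * f i z \<le> 0" using u(1) i by (simp add: mult_nonneg_nonpos)
    qed
    then have "0 \<le> c" using gz by (simp add: c_def)
    have "g x = c * f j x + (\<Sum>i\<in>I. u i * f i x)" for x
    proof -
      have "g x = f j x * g z + g (p x)" using p [OF insert.prems(2), of x] by simp
      also have "g (p x) = (\<Sum>i\<in>I. u i * (f i x - f j x * f i z))"
        unfolding u(2) using p insert.prems(1) by (intro sum.cong) auto
      also have "\<dots> = (\<Sum>i\<in>I. u i * f i x) - f j x * (\<Sum>i\<in>I. u i * f i z)"
        by (simp add: sum_subtractf sum_distrib_left algebra_simps)
      finally show ?thesis by (simp add: c_def algebra_simps)
    qed
    moreover have "(\<Sum>i\<in>insert j I. (u(j := c)) i * f i x) = c * f j x + (\<Sum>i\<in>I. u i * f i x)" for x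
      using insert.hyps by (simp add: sum.insert) (rule sum.cong, auto)
    ultimately show ?thesis using u(1) \<open>0 \<le> c\<close> by (intro exI [of _ "u(j := c)"]) auto
  qed
qed

text \<open>By Farkas's lemma the total weight is a nonnegative combination of the edge weights. Evaluated at the
indicator function of a vertex this shows that every load is \<open>1\<close>, and at the constant
function \<open>1\<close> it gives the size of the matching.\<close>

lemma perfect_fractional_matchingI:
  fixes H :: "'a hypergraph"
  assumes finV: "finite (verts H)" and finE: "finite (edges H)" and k: "0 < k"
    and edge: "\<And>e. e \<in> edges H \<Longrightarrow> e \<subseteq> verts H \<and> card e = k"
    and weights: "\<And>x :: 'a \<Rightarrow> real. (\<And>e. e \<in> edges H \<Longrightarrow> 0 \<le> sum x e) \<Longrightarrow> 0 \<le> sum x (verts H)"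
  shows "\<exists>\<omega>. perfect_fractional_matching k H \<omega>"
proof -
  have lin: "linear_on_functions (\<lambda>x. - sum x e)" for e :: "'a set"
    by (simp add: linear_on_functions_def sum.distrib sum_distrib_left algebra_simps sum_negf)
  have "\<exists>u. (\<forall>e\<in>edges H. 0 \<le> u e) \<and> (\<forall>x :: 'a \<Rightarrow> real. - sum x (verts H) = (\<Sum>e\<in>edges H. u e * (- sum x e)))"
  proof (rule farkas [OF finE, where f = "\<lambda>e x. - sum x e" and g = "\<lambda>x. - sum x (verts H)"])
    show "- sum x (verts H) \<le> 0" if "\<And>e. e \<in> edges H \<Longrightarrow> - sum x e \<le> 0" for x :: "'a \<Rightarrow> real"
      using weights [of x] that by simp
  qed (rule lin)+
  then obtain u where u0: "\<And>e. e \<in> edges H \<Longrightarrow> 0 \<le> u e"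
    and u: "\<And>x :: 'a \<Rightarrow> real. sum x (verts H) = (\<Sum>e\<in>edges H. u e * sum x e)"
    by (auto simp: sum_negf)
  have load: "(\<Sum>e\<in>{e \<in> edges H. v \<in> e}. u e) = 1" if v: "v \<in> verts H" for v
  proof -
    have "(1::real) = (\<Sum>w\<in>verts H. if w = v then 1 else 0)" using v finV by simp
    also have "\<dots> = (\<Sum>e\<in>edges H. u e * (\<Sum>w\<in>e. if w = v then 1 else 0))" by (rule u)
    also have "\<dots> = (\<Sum>e\<in>edges H. if v \<in> e then u e else 0)"
      using finite_subset [OF conjunct1 [OF edge] finV] by (intro sum.cong) auto
    also have "\<dots> = (\<Sum>e\<in>{e \<in> edges H. v \<in> e}. u e)"
      using finE by (simp add: sum.inter_filter)
    finally show ?thesis ..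
  qed
  have "real (card (verts H)) = (\<Sum>e\<in>edges H. u e * (\<Sum>v\<in>e. 1))" using u [of "\<lambda>_. 1"] by simp
  also have "\<dots> = (\<Sum>e\<in>edges H. u e) * k"
    using edge by (simp add: sum_distrib_right)
  finally have total: "(\<Sum>e\<in>edges H. u e) = real (card (verts H)) / real k"
    using k by (simp add: field_simps)
  have "u e \<le> 1" if e: "e \<in> edges H" for e
  proof -
    have "e \<noteq> {}" using edge [OF e] k by auto
    then obtain v where v: "v \<in> e" by blast
    have "u e \<le> (\<Sum>e\<in>{e \<in> edges H. v \<in> e}. u e)"
      using finE e v u0 by (intro member_le_sum) auto
    also have "\<dots> = 1" using load edge [OF e] v by blast
    finally show ?thesis .
  qed
  then show ?thesis
    using u0 load total unfolding perfect_fractional_matching_def fractional_matching_def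
    by (intro exI [of _ u]) auto
qed

section \<open>Tight connectivity as reachability\<close>

definition tight_adj :: "nat \<Rightarrow> 'a set set \<Rightarrow> ('a set \<times> 'a set) set" where
  "tight_adj k E = {(e, f). e \<in> E \<and> f \<in> E \<and> card (e \<inter> f) = k - 1}"

definition tight_class :: "nat \<Rightarrow> 'a set set \<Rightarrow> 'a set \<Rightarrow> 'a set set" where
  "tight_class k E e = {f \<in> E. (e, f) \<in> (tight_adj k E)\<^sup>*}"

lemma sym_tight_adj: "sym (tight_adj k E)"
  unfolding tight_adj_def by (auto intro!: symI simp: Int_commute)

lemma tight_adj_rtrancl_sym: "(e, f) \<in> (tight_adj k E)\<^sup>* \<Longrightarrow> (f, e) \<in> (tight_adj k E)\<^sup>*"
  by (rule symD [OF sym_rtrancl [OF sym_tight_adj]])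

lemma tight_adj_rtrancl_mono: "D \<subseteq> E \<Longrightarrow> (e, f) \<in> (tight_adj k D)\<^sup>* \<Longrightarrow> (e, f) \<in> (tight_adj k E)\<^sup>*"
  by (rule rtrancl_mono [THEN subsetD]) (auto simp: tight_adj_def)

lemma tightly_connected_iff:
  "tightly_connected k G H \<longleftrightarrow>
     subgraph H G \<and> (\<forall>v\<in>verts H. \<exists>e\<in>edges H. v \<in> e) \<and> edges H \<noteq> {} \<and>
     (\<forall>e\<in>edges H. \<forall>f\<in>edges H. (e, f) \<in> (tight_adj k (edges H))\<^sup>*)"
proof (cases "edges H \<subseteq> edges G")
  case True
  have "{(x, y). {x, y} \<in> edges (induced_subgraph (line_graph k G) (edges H))} = tight_adj k (edges H)"
    using True
    by (auto simp: induced_subgraph_def line_graph_def tight_adj_def doubleton_eq_iff Int_commute)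
  moreover have "verts (induced_subgraph (line_graph k G) (edges H)) = edges H"
    using True by (auto simp: induced_subgraph_def line_graph_def)
  ultimately show ?thesis
    unfolding tightly_connected_def connected_graph_def by simp
next
  case False
  then show ?thesis unfolding tightly_connected_def subgraph_def by blast
qed

text \<open>A path to an edge of the class never leaves the class, so it is a path inside the class.\<close>

lemma tight_class_connected:
  assumes e: "e \<in> tight_class k E e0" and f: "f \<in> tight_class k E e0"
  shows "(e, f) \<in> (tight_adj k (tight_class k E e0))\<^sup>*"
proof -
  have *: "(e0, f) \<in> (tight_adj k (tight_class k E e0))\<^sup>*" if "(e0, f) \<in> (tight_adj k E)\<^sup>*" for f
    using that
  proof (induction rule: rtrancl_induct)
    case base
    show ?case by simp
  next
    case (step f g)
    then have "f \<in> E" "g \<in> E" by (auto simp: tight_adj_def)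
    moreover have "(e0, g) \<in> (tight_adj k E)\<^sup>*" by (rule rtrancl_into_rtrancl) (use step in auto)
    ultimately have "(f, g) \<in> tight_adj k (tight_class k E e0)"
      using step by (auto simp: tight_adj_def tight_class_def)
    then show ?case using step.IH by (rule rtrancl_into_rtrancl [rotated])
  qed
  have "(e0, e) \<in> (tight_adj k (tight_class k E e0))\<^sup>*" "(e0, f) \<in> (tight_adj k (tight_class k E e0))\<^sup>*"
    using e f * by (auto simp: tight_class_def)
  then show ?thesis by (rule rtrancl_trans [OF tight_adj_rtrancl_sym])
qed

lemma tight_component_tight_class:
  assumes sub: "\<And>e. e \<in> E \<Longrightarrow> e \<subseteq> V" and e0: "e0 \<in> E"
    and cover: "\<And>v. v \<in> V \<Longrightarrow> \<exists>e\<in>tight_class k E e0. v \<in> e"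
  shows "tight_component k (Hypergraph V E) (Hypergraph V (tight_class k E e0))"
proof -
  have e0_class: "e0 \<in> tight_class k E e0" using e0 by (simp add: tight_class_def)
  have "tightly_connected k (Hypergraph V E) (Hypergraph V (tight_class k E e0))"
    unfolding tightly_connected_iff
  proof (intro conjI ballI)
    show "subgraph (Hypergraph V (tight_class k E e0)) (Hypergraph V E)"
      using sub by (auto simp: subgraph_def tight_class_def)
  qed (use tight_class_connected cover e0_class in auto)
  moreover have "\<not> tight_class k E e0 \<subset> edges H"
    if H: "tightly_connected k (Hypergraph V E) H" for H
  proof
    assume less: "tight_class k E e0 \<subset> edges H"
    have HE: "edges H \<subseteq> E" using H by (simp add: tightly_connected_iff subgraph_def)
    have "edges H \<subseteq> tight_class k E e0"
    proof
      fix f assume f: "f \<in> edges H"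
      then have "(e0, f) \<in> (tight_adj k (edges H))\<^sup>*"
        using H less e0_class unfolding tightly_connected_iff by blast
      then show "f \<in> tight_class k E e0"
        using tight_adj_rtrancl_mono [OF HE] f HE by (auto simp: tight_class_def)
    qed
    then show False using less by blast
  qed
  ultimately show ?thesis unfolding tight_component_def by simp
qed

text \<open>The lists are without repetition because \<open>k\<close> entries form a set of size \<open>k\<close>.\<close>

lemma moves_tight_adj:
  assumes uniform: "\<And>e. e \<in> E \<Longrightarrow> card e = k"
    and move: "(xs, ys) \<in> moves (ordered_edge k E)"
  shows "set xs = set ys \<or> (set xs, set ys) \<in> tight_adj k E"
proof -
  obtain i w where xs: "length xs = k" "set xs \<in> E" and ys: "length ys = k" "set ys \<in> E"
    and i: "i < k" and ys_eq: "ys = xs[i := w]"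
    using move unfolding moves_def by auto
  have dist: "distinct xs" using uniform [OF xs(2)] xs(1) by (intro card_distinct) simp
  have set_ys: "set ys = insert w (set xs - {xs ! i})"
    using set_update_distinct [OF dist] i xs(1) ys_eq by simp
  have xi: "xs ! i \<in> set xs" using i xs(1) by simp
  show ?thesis
  proof (cases "w \<in> set xs")
    case True
    then have "set ys \<subseteq> set xs" using set_ys by auto
    then show ?thesis using uniform xs(2) ys(2) by (metis List.finite_set card_subset_eq)
  next
    case False
    then have "set xs \<inter> set ys = set xs - {xs ! i}" using set_ys by auto
    then have "card (set xs \<inter> set ys) = k - 1" using uniform [OF xs(2)] xi by simp
    then show ?thesis using xs ys by (simp add: tight_adj_def)
  qed
qed

lemma moves_tight_class:
  assumes uniform: "\<And>e. e \<in> E \<Longrightarrow> card e = k"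
    and move: "(xs, ys) \<in> (moves (ordered_edge k E))\<^sup>*" and xs: "set xs \<in> tight_class k E e0"
  shows "set ys \<in> tight_class k E e0 \<and> (xs, ys) \<in> (moves (ordered_edge k (tight_class k E e0)))\<^sup>*"
  using move
proof (induction rule: rtrancl_induct)
  case base
  show ?case using xs by simp
next
  case (step ys zs)
  have ys: "set ys \<in> tight_class k E e0" using step.IH ..
  have zs: "set zs \<in> tight_class k E e0"
  proof -
    have "set ys = set zs \<or> (set ys, set zs) \<in> tight_adj k E"
      by (rule moves_tight_adj [OF uniform step(2)])
    then show ?thesis
    proof
      assume adj: "(set ys, set zs) \<in> tight_adj k E"
      have "(e0, set zs) \<in> (tight_adj k E)\<^sup>*"
        by (rule rtrancl_into_rtrancl [OF _ adj]) (use ys in \<open>simp add: tight_class_def\<close>)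
      then show ?thesis using adj by (simp add: tight_class_def tight_adj_def)
    qed (use ys in simp)
  qed
  have "(ys, zs) \<in> moves (ordered_edge k (tight_class k E e0))"
    using step(2) ys zs unfolding moves_def by auto
  then have "(xs, zs) \<in> (moves (ordered_edge k (tight_class k E e0)))\<^sup>*"
    using step.IH by (auto elim: rtrancl_into_rtrancl)
  then show ?case using zs by simp
qed

lemma exists_smallest_subset:
  fixes x :: "'a \<Rightarrow> 'b :: linorder"
  assumes "finite V" and "m \<le> card V"
  shows "\<exists>S\<subseteq>V. card S = m \<and> (\<forall>u\<in>S. \<forall>v\<in>V - S. x u \<le> x v)"
  using assms(2)
proof (induction m)
  case 0
  show ?case by (rule exI [of _ "{}"]) simp
next
  case (Suc m)
  then obtain S where S: "S \<subseteq> V" "card S = m" "\<forall>u\<in>S. \<forall>v\<in>V - S. x u \<le> x v" by auto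
  have finS: "finite S" using S(1) assms(1) by (rule finite_subset)
  have "V - S \<noteq> {}" using Suc.prems S card_mono [OF finS, of V] by auto
  then obtain v where v: "v \<in> V - S" "\<forall>u\<in>V - S. x v \<le> x u"
    using assms(1) ex_min_if_finite [of "x ` (V - S)"] by (fastforce simp: not_less)
  have "card (insert v S) = Suc m" using v S finS by simp
  then show ?case using S v by (intro exI [of _ "insert v S"]) auto
qed

section \<open>The component that all links agree on\<close>

text \<open>The degree condition for \<open>k = d + r + 1\<close>, in tuples. The summand \<open>(card V + 1) ^ Suc r\<close> in place of
\<open>card V ^ Suc r\<close> leaves room for comparing links in two hypergraphs that arise from the same
larger one by deleting different vertices.\<close>

locale dense_hypergraph =
  fixes V :: "'a set" and E :: "'a set set" and d r :: nat
  assumes finite_V: "finite V"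
    and uniform: "e \<in> E \<Longrightarrow> e \<subseteq> V \<and> card e = d + Suc r"
    and d_pos: "0 < d"
    and large: "d + Suc r \<le> card V"
    and degree: "S \<subseteq> V \<Longrightarrow> card S = d \<Longrightarrow>
      2 * Suc r * card {xs \<in> tuples V (Suc r). S \<union> set xs \<notin> E} + (card V + 1) ^ Suc r
        < 2 * card V ^ Suc r"
begin

definition link :: "'a set \<Rightarrow> 'a set set" where
  "link S = {T. T \<subseteq> V \<and> T \<inter> S = {} \<and> card T = Suc r \<and> S \<union> T \<in> E}"

definition vicinity :: "'a set \<Rightarrow> 'a set set" where
  "vicinity S = dense_uniform.giant V (link S) r"

abbreviation vicinity_tuples :: "'a set \<Rightarrow> 'a list set" where
  "vicinity_tuples S \<equiv> {xs \<in> tuples V (Suc r). set xs \<in> vicinity S}"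

text \<open>An edge has \<open>d + r + 1\<close> vertices, so the \<open>r + 1\<close> entries must be distinct and outside \<open>S\<close>.\<close>

lemma mem_link_iff:
  assumes S: "S \<subseteq> V" "card S = d" and xs: "xs \<in> tuples V (Suc r)"
  shows "set xs \<in> link S \<longleftrightarrow> S \<union> set xs \<in> E"
proof
  assume edge: "S \<union> set xs \<in> E"
  have finS: "finite S" using S(1) finite_V by (rule finite_subset)
  have le: "card (set xs) \<le> Suc r" using card_length [of xs] xs by (simp add: tuples_def)
  have "card S + card (set xs) = d + Suc r + card (S \<inter> set xs)"
    using card_Un_Int [OF finS, of "set xs"] uniform [OF edge] by simp
  then have "card (set xs) = Suc r" "card (S \<inter> set xs) = 0" using le S by auto
  then show "set xs \<in> link S" using edge xs finS by (auto simp: link_def tuples_def)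
qed (simp add: link_def)

lemma link_missing:
  assumes "S \<subseteq> V" "card S = d"
  shows "{xs \<in> tuples V (Suc r). set xs \<notin> link S} = {xs \<in> tuples V (Suc r). S \<union> set xs \<notin> E}"
  using mem_link_iff [OF assms] by blast

lemma link_dense:
  assumes "S \<subseteq> V" "card S = d"
  shows "dense_uniform V (link S) r"
proof
  have "card V ^ Suc r \<le> (card V + 1) ^ Suc r" by (rule power_mono) auto
  then show "2 * Suc r * card {xs \<in> tuples V (Suc r). set xs \<notin> link S} < card V ^ Suc r"
    using degree [OF assms] unfolding link_missing [OF assms] by simp
qed (auto simp: link_def finite_V)

lemma vicinityD:
  assumes "S \<subseteq> V" "card S = d" "T \<in> vicinity S"
  shows "T \<subseteq> V" "T \<inter> S = {}" "card T = Suc r" "S \<union> T \<in> E"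
  using dense_uniform.giant_subset [OF link_dense [OF assms(1,2)]] assms(3)
  by (auto simp: vicinity_def link_def)

lemma vicinity_tuples_large:
  assumes "S \<subseteq> V" "card S = d"
  shows "(card V + 1) ^ Suc r < 2 * card (vicinity_tuples S)"
proof -
  have "card V ^ Suc r \<le> card (vicinity_tuples S)
      + Suc r * card {xs \<in> tuples V (Suc r). S \<union> set xs \<notin> E}"
    using dense_uniform.giant_tuples_large [OF link_dense [OF assms]]
      dense_uniform.missing_def [OF link_dense [OF assms]] link_missing [OF assms]
    by (simp add: vicinity_def)
  then show ?thesis using degree [OF assms] by simp
qed

lemma vicinity_tuples_half:
  assumes "S \<subseteq> V" "card S = d"
  shows "card V ^ Suc r < 2 * card (vicinity_tuples S)"
proof -
  have "card V ^ Suc r \<le> (card V + 1) ^ Suc r" by (rule power_mono) auto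
  then show ?thesis using vicinity_tuples_large [OF assms] by simp
qed

lemma vicinities_meet:
  assumes S: "S \<subseteq> V" "card S = d" and S': "S' \<subseteq> V" "card S' = d"
  shows "\<exists>xs\<in>tuples V (Suc r). set xs \<in> vicinity S \<inter> vicinity S'"
proof (rule ccontr)
  assume "\<not> ?thesis"
  then have "vicinity_tuples S \<inter> vicinity_tuples S' = {}" by blast
  then have "card (vicinity_tuples S) + card (vicinity_tuples S')
      = card (vicinity_tuples S \<union> vicinity_tuples S')"
    by (intro card_Un_disjoint [symmetric]) (auto simp: finite_tuples finite_V)
  also have "\<dots> \<le> card (tuples V (Suc r))"
    by (rule card_mono) (auto simp: finite_tuples finite_V)
  finally show False
    using vicinity_tuples_half [OF S] vicinity_tuples_half [OF S'] by (simp add: card_tuples finite_V)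
qed

lemma vicinity_nonempty: "S \<subseteq> V \<Longrightarrow> card S = d \<Longrightarrow> \<exists>xs\<in>tuples V (Suc r). set xs \<in> vicinity S"
  using vicinities_meet by blast

abbreviation edge_moves :: "('a list \<times> 'a list) set" where
  "edge_moves \<equiv> moves (ordered_edge (d + Suc r) E)"

text \<open>Neighbouring giant edges differ in at most one vertex, so each step replaces one entry. The ordering
of the last edge cannot be prescribed here.\<close>

lemma vicinity_transport:
  assumes S: "S \<subseteq> V" "card S = d" and ss: "set ss = S" "length ss = d"
    and T: "T \<in> vicinity S" and T': "T' \<in> vicinity S" and xs: "set xs = T" "length xs = Suc r"
  shows "\<exists>ys. set ys = T' \<and> length ys = Suc r \<and> (ss @ xs, ss @ ys) \<in> edge_moves\<^sup>*"
proof -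
  have "(T, T') \<in> {(T, T'). T \<in> vicinity S \<and> T' \<in> vicinity S \<and> (\<exists>R. card R = r \<and> R \<subseteq> T \<and> R \<subseteq> T')}\<^sup>*"
    using dense_uniform.giant_connected [OF link_dense [OF S]] T T' unfolding vicinity_def by blast
  then show ?thesis
  proof (induction rule: rtrancl_induct)
    case base
    then show ?case using xs by auto
  next
    case (step T T')
    then obtain ys where ys: "set ys = T" "length ys = Suc r" "(ss @ xs, ss @ ys) \<in> edge_moves\<^sup>*" by blast
    obtain R where T: "T \<in> vicinity S" and T': "T' \<in> vicinity S" and R: "card R = r" "R \<subseteq> T" "R \<subseteq> T'"
      using step.hyps by blast
    note vT = vicinityD [OF S T] and vT' = vicinityD [OF S T']
    have fin: "finite T" "finite T'" using vT vT' finite_V finite_subset by blast+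
    then have finR: "finite R" using R finite_subset by blast
    have "card (T - R) = 1" "card (T' - R) = 1"
      using vT(3) vT'(3) R finR by (simp_all add: card_Diff_subset)
    then obtain a b where ab: "T - R = {a}" "T' - R = {b}" by (meson card_1_singletonE)
    then have a: "a \<in> T" and Ta: "T - {a} = R" and T'b: "T' = insert b R" using R by auto
    obtain i where i: "i < Suc r" "ys ! i = a" using a ys by (metis in_set_conv_nth)
    have "distinct ys" using ys vT(3) by (intro card_distinct) simp
    then have set': "set (ys[i := b]) = T'"
      using set_update_distinct [of ys i b] i ys Ta T'b by simp
    have "(ss @ ys, (ss @ ys)[d + i := b]) \<in> edge_moves"
      by (rule movesI) (use ss ys i set' vT(4) vT'(4) in \<open>simp_all add: list_update_append\<close>)
    then have "(ss @ ys, ss @ ys[i := b]) \<in> edge_moves"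
      using ss by (simp add: list_update_append)
    then have "(ss @ xs, ss @ ys[i := b]) \<in> edge_moves\<^sup>*"
      by (rule rtrancl_into_rtrancl [OF ys(3)])
    then show ?case using set' ys by (intro exI [of _ "ys[i := b]"]) simp
  qed
qed

text \<open>Any edge \<open>T\<close> inside a clique with one spare vertex works, since all the intermediate sets stay inside
the clique. For \<open>r = 0\<close> there is only one ordering.\<close>

lemma vicinity_switcher:
  assumes S: "S \<subseteq> V" "card S = d" and ss: "set ss = S" "length ss = d"
  shows "\<exists>T\<in>vicinity S. \<forall>xs ys. set xs = T \<longrightarrow> length xs = Suc r \<longrightarrow> set ys = T \<longrightarrow> length ys = Suc r
    \<longrightarrow> (ss @ xs, ss @ ys) \<in> edge_moves\<^sup>*"
proof (cases "r = 0")
  case True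
  obtain T where T: "T \<in> vicinity S" using vicinity_nonempty [OF S] by blast
  show ?thesis
  proof (intro bexI [OF _ T] allI impI)
    fix xs ys assume "set xs = T" "length xs = Suc r" "set ys = T" "length ys = Suc r"
    then have "xs = ys" using True by (auto simp: length_Suc_conv)
    then show "(ss @ xs, ss @ ys) \<in> edge_moves\<^sup>*" by simp
  qed
next
  case False
  then obtain U where U: "U \<subseteq> V" "card U = r + 2"
    "\<And>T. T \<subseteq> U \<Longrightarrow> card T = Suc r \<Longrightarrow> T \<in> vicinity S"
    using dense_uniform.giant_clique [OF link_dense [OF S]] unfolding vicinity_def by blast
  have finU: "finite U" using U(1) finite_V by (rule finite_subset)
  obtain T where T: "T \<subseteq> U" "card T = Suc r"
    using obtain_subset_with_card_n [of "Suc r" U] U(2) by auto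
  have "(ss @ xs, ss @ ys) \<in> edge_moves\<^sup>*"
    if xs: "set xs = T" "length xs = Suc r" and ys: "set ys = T" "length ys = Suc r" for xs ys
  proof (rule moves_append)
    have dist: "distinct xs" "distinct ys" using xs ys T by (auto intro: card_distinct)
    show "(xs, ys) \<in> (moves (\<lambda>zs. distinct zs \<and> set zs \<subseteq> U))\<^sup>*"
      by (rule distinct_tuples_connected [OF finU]) (use xs ys T U dist in auto)
    show "distinct xs \<and> set xs \<subseteq> U" using dist xs T by simp
    show "ordered_edge (d + Suc r) E (ss @ zs)" if "distinct zs \<and> set zs \<subseteq> U" "length zs = length xs" for zs
    proof -
      have "set zs \<in> vicinity S" using that xs U(3) [of "set zs"] by (simp add: distinct_card)
      then show ?thesis using vicinityD(4) [OF S] that xs ss by simp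
    qed
  qed
  then show ?thesis using U(3) [OF T] by blast
qed

text \<open>Transport both edges to the switching edge and reorder there.\<close>

lemma vicinity_connected:
  assumes S: "S \<subseteq> V" "card S = d" and ss: "set ss = S" "length ss = d"
    and xs: "set xs \<in> vicinity S" "length xs = Suc r" and ys: "set ys \<in> vicinity S" "length ys = Suc r"
  shows "(ss @ xs, ss @ ys) \<in> edge_moves\<^sup>*"
proof -
  obtain T where T: "T \<in> vicinity S"
    and switch: "\<And>xs ys. set xs = T \<Longrightarrow> length xs = Suc r \<Longrightarrow> set ys = T \<Longrightarrow> length ys = Suc r
      \<Longrightarrow> (ss @ xs, ss @ ys) \<in> edge_moves\<^sup>*"
    using vicinity_switcher [OF S ss] by blast
  obtain xs' where xs': "set xs' = T" "length xs' = Suc r" "(ss @ xs, ss @ xs') \<in> edge_moves\<^sup>*"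
    using vicinity_transport [OF S ss xs(1) T refl xs(2)] by blast
  obtain ys' where ys': "set ys' = T" "length ys' = Suc r" "(ss @ ys, ss @ ys') \<in> edge_moves\<^sup>*"
    using vicinity_transport [OF S ss ys(1) T refl ys(2)] by blast
  have "(ss @ xs, ss @ ys') \<in> edge_moves\<^sup>*"
    by (rule rtrancl_trans [OF xs'(3) switch]) (use xs' ys' in auto)
  then show ?thesis by (rule rtrancl_trans [OF _ sym_moves_rtrancl [OF ys'(3)]])
qed

definition rooted :: "'a list \<Rightarrow> bool" where
  "rooted zs \<longleftrightarrow> length zs = d + Suc r \<and> distinct (take d zs) \<and> set (take d zs) \<subseteq> V
     \<and> set (drop d zs) \<in> vicinity (set (take d zs))"

lemma rooted_append:
  "length ss = d \<Longrightarrow> rooted (ss @ xs) \<longleftrightarrow>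
     length xs = Suc r \<and> distinct ss \<and> set ss \<subseteq> V \<and> set xs \<in> vicinity (set ss)"
  by (auto simp: rooted_def)

lemma rooted_cases:
  assumes "rooted zs"
  obtains ss xs where "zs = ss @ xs" "length ss = d" "length xs = Suc r" "distinct ss" "set ss \<subseteq> V"
    "card (set ss) = d" "set xs \<in> vicinity (set ss)"
proof (rule that [of "take d zs" "drop d zs"])
  show "card (set (take d zs)) = d" using assms unfolding rooted_def by (simp add: distinct_card)
qed (use assms in \<open>auto simp: rooted_def\<close>)

lemma rooted_edge: "rooted zs \<Longrightarrow> set zs \<in> E"
  by (elim rooted_cases) (auto dest: vicinityD)

lemma rooted_distinct:
  assumes "rooted zs"
  shows "distinct zs"
  using uniform [OF rooted_edge [OF assms]] assms by (intro card_distinct) (simp add: rooted_def)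

text \<open>The first \<open>d\<close> entries are changed one at a time. Before each change the other entries are moved to
an edge that is giant in both links concerned.\<close>

lemma rooted_connected:
  assumes "rooted zs" and "rooted zs'"
  shows "(zs, zs') \<in> edge_moves\<^sup>*"
proof -
  obtain ss xs where zs: "zs = ss @ xs" "length ss = d" "length xs = Suc r" "distinct ss" "set ss \<subseteq> V"
    "card (set ss) = d" "set xs \<in> vicinity (set ss)" using assms(1) by (rule rooted_cases)
  obtain ss' xs' where zs': "zs' = ss' @ xs'" "length ss' = d" "length xs' = Suc r" "distinct ss'" "set ss' \<subseteq> V"
    "card (set ss') = d" "set xs' \<in> vicinity (set ss')" using assms(2) by (rule rooted_cases)
  have "(ss, ss') \<in> (moves (\<lambda>zs. distinct zs \<and> set zs \<subseteq> V))\<^sup>*"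
    by (rule distinct_tuples_connected [OF finite_V]) (use zs zs' large in auto)
  then have "length ss' = d \<and> (\<forall>xs'. rooted (ss' @ xs') \<longrightarrow> (zs, ss' @ xs') \<in> edge_moves\<^sup>*)"
  proof (induction rule: rtrancl_induct)
    case base
    have "(zs, ss @ xs') \<in> edge_moves\<^sup>*" if "rooted (ss @ xs')" for xs'
      using vicinity_connected [OF zs(5,6) refl zs(2,7,3), of xs'] that zs(1,2) by (simp add: rooted_append)
    then show ?case using zs by blast
  next
    case (step ss1 ss2)
    then obtain i w where ss1: "distinct ss1" "set ss1 \<subseteq> V" and ss2: "distinct ss2" "set ss2 \<subseteq> V"
      and i: "i < length ss1" "ss2 = ss1[i := w]"
      unfolding moves_def by blast
    have len: "length ss1 = d" "length ss2 = d" using step.IH i by auto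
    have card: "card (set ss1) = d" "card (set ss2) = d" using len ss1 ss2 by (simp_all add: distinct_card)
    obtain ys where ys: "ys \<in> tuples V (Suc r)" "set ys \<in> vicinity (set ss1)" "set ys \<in> vicinity (set ss2)"
      using vicinities_meet [OF ss1(2) card(1) ss2(2) card(2)] by blast
    then have ly: "length ys = Suc r" by (simp add: tuples_def)
    have "rooted (ss1 @ ys)" using ys ly len ss1 by (simp add: rooted_append)
    then have 1: "(zs, ss1 @ ys) \<in> edge_moves\<^sup>*" using step.IH by blast
    have "(ss1 @ ys, (ss1 @ ys)[i := w]) \<in> edge_moves"
      by (rule movesI)
        (use len ly i vicinityD(4) [OF ss1(2) card(1) ys(2)] vicinityD(4) [OF ss2(2) card(2) ys(3)]
          in \<open>simp_all add: list_update_append\<close>)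
    then have 2: "(ss1 @ ys, ss2 @ ys) \<in> edge_moves" using i by (simp add: list_update_append)
    have "(zs, ss2 @ xs') \<in> edge_moves\<^sup>*" if "rooted (ss2 @ xs')" for xs'
    proof -
      have "(ss2 @ ys, ss2 @ xs') \<in> edge_moves\<^sup>*"
        using vicinity_connected [OF ss2(2) card(2) refl len(2) ys(3) ly, of xs'] that len
        by (simp add: rooted_append)
      then show ?thesis by (rule rtrancl_trans [OF rtrancl_into_rtrancl [OF 1 2]])
    qed
    then show ?case using len by blast
  qed
  then show ?thesis using assms(2) zs'(1) by blast
qed

lemma exists_rooted:
  assumes "S \<subseteq> V" "card S = d" "T \<in> vicinity S"
  shows "\<exists>zs. rooted zs \<and> set zs = S \<union> T"
proof -
  have "finite S" "finite T" using assms finite_V vicinityD(1) [OF assms] finite_subset by blast+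
  then obtain ss xs where "set ss = S" "distinct ss" "set xs = T" "distinct xs"
    using finite_distinct_list by metis
  moreover from this have "length ss = d" "length xs = Suc r"
    using assms vicinityD(3) [OF assms] by (auto simp: distinct_card [symmetric])
  ultimately show ?thesis using assms by (intro exI [of _ "ss @ xs"]) (simp add: rooted_append)
qed

text \<open>More than half of all repetition-free \<open>k\<close>-tuples are rooted and rotation is injective on them, so
the rooted tuples and their rotations cannot be disjoint.\<close>

lemma exists_rooted_rotate: "\<exists>zs. rooted zs \<and> rooted (rotate1 zs)"
proof (rule ccontr)
  assume no: "\<not> ?thesis"
  define D where "D = {ss \<in> tuples V d. distinct ss}"
  define K where "K = {zs \<in> tuples V (d + Suc r). distinct zs}"
  have fin: "finite (tuples V m)" for m by (rule finite_tuples [OF finite_V])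
  have finD: "finite D" and finK: "finite K" unfolding D_def K_def by (simp_all add: fin)
  have sub: "Collect rooted \<subseteq> K"
  proof
    fix zs assume "zs \<in> Collect rooted"
    then have zs: "rooted zs" by simp
    then have "length zs = d + Suc r" by (simp add: rooted_def)
    then show "zs \<in> K"
      using rooted_distinct [OF zs] uniform [OF rooted_edge [OF zs]] by (simp add: K_def tuples_def)
  qed
  then have fin_rooted: "finite (Collect rooted)" using finK by (rule finite_subset)
  have "rotate1 ` K \<subseteq> K" by (auto simp: K_def tuples_def)
  then have sub': "rotate1 ` Collect rooted \<subseteq> K" using sub by blast
  have inj: "inj_on rotate1 (Collect rooted)"
    by (rule inj_on_subset [OF inj_rotate1]) simp
  have "Collect rooted \<inter> rotate1 ` Collect rooted = {}" using no by blast
  then have "card (Collect rooted) + card (rotate1 ` Collect rooted)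
      = card (Collect rooted \<union> rotate1 ` Collect rooted)"
    using fin_rooted by (intro card_Un_disjoint [symmetric]) auto
  also have "\<dots> \<le> card K" using sub sub' finK by (intro card_mono) auto
  finally have 1: "2 * card (Collect rooted) \<le> card K" using inj by (simp add: card_image)
  have "(\<lambda>zs. (take d zs, drop d zs)) ` K \<subseteq> D \<times> tuples V (Suc r)"
    by (auto simp: K_def D_def tuples_def dest: in_set_takeD in_set_dropD)
  then have "card ((\<lambda>zs. (take d zs, drop d zs)) ` K) \<le> card (D \<times> tuples V (Suc r))"
    by (intro card_mono) (auto simp: finD fin)
  moreover have "inj_on (\<lambda>zs. (take d zs, drop d zs)) K"
    by (rule inj_on_inverseI [where g = "\<lambda>(p, q). p @ q"]) simp
  ultimately have 2: "card K \<le> card D * card V ^ Suc r"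
    by (simp add: card_image card_cartesian_product card_tuples finite_V del: power_Suc)
  have D: "set ss \<subseteq> V" "card (set ss) = d" "length ss = d" "distinct ss" if "ss \<in> D" for ss
    using that by (auto simp: D_def tuples_def distinct_card)
  have "D \<noteq> {}"
  proof -
    obtain S where "S \<subseteq> V" "card S = d" "finite S"
      using obtain_subset_with_card_n [of d V] large by auto
    then obtain ss where "set ss = S" "distinct ss" using finite_distinct_list by blast
    then have "ss \<in> D" using \<open>S \<subseteq> V\<close> \<open>card S = d\<close> by (auto simp: D_def tuples_def distinct_card [symmetric])
    then show ?thesis by blast
  qed
  then have "(\<Sum>ss\<in>D. card V ^ Suc r) < (\<Sum>ss\<in>D. 2 * card (vicinity_tuples (set ss)))"
    using finD D vicinity_tuples_half by (intro sum_strict_mono) auto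
  then have "card D * card V ^ Suc r < 2 * (\<Sum>ss\<in>D. card (vicinity_tuples (set ss)))"
    by (simp add: sum_distrib_left)
  also have "(\<Sum>ss\<in>D. card (vicinity_tuples (set ss))) = card (Sigma D (\<lambda>ss. vicinity_tuples (set ss)))"
    using finD by (simp add: fin)
  also have "\<dots> = card ((\<lambda>(ss, xs). ss @ xs) ` Sigma D (\<lambda>ss. vicinity_tuples (set ss)))"
    by (rule card_image [symmetric]) (auto simp: inj_on_def D_def tuples_def)
  also have "\<dots> \<le> card (Collect rooted)"
    using D by (intro card_mono fin_rooted) (auto simp: rooted_append tuples_def)
  finally show False using 1 2 by simp
qed

text \<open>The choice of the rooted tuple does not matter, as all rooted tuples are connected.\<close>

definition giant_component :: "'a hypergraph" where
  "giant_component = Hypergraph V (tight_class (d + Suc r) E (set (SOME zs. rooted zs)))"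

abbreviation giant_edges :: "'a set set" where
  "giant_edges \<equiv> edges giant_component"

lemma verts_giant_component [simp]: "verts giant_component = V"
  by (simp add: giant_component_def)

lemma giant_edges_subset: "giant_edges \<subseteq> E"
  by (auto simp: giant_component_def tight_class_def)

lemma rooted_SOME: "rooted (SOME zs. rooted zs)"
  using exists_rooted_rotate by (blast intro: someI)

lemma uniform_card: "e \<in> E \<Longrightarrow> card e = d + Suc r"
  using uniform by blast

lemma rooted_giant:
  assumes "rooted zs"
  shows "set zs \<in> giant_edges"
proof -
  have "set (SOME zs. rooted zs) \<in> tight_class (d + Suc r) E (set (SOME zs. rooted zs))"
    using rooted_edge [OF rooted_SOME] by (simp add: tight_class_def)
  then show ?thesis
    using moves_tight_class [OF uniform_card rooted_connected [OF rooted_SOME assms]]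
    by (simp add: giant_component_def)
qed

lemma vicinity_giant: "S \<subseteq> V \<Longrightarrow> card S = d \<Longrightarrow> T \<in> vicinity S \<Longrightarrow> S \<union> T \<in> giant_edges"
  using exists_rooted rooted_giant by metis

lemma tight_component_giant: "tight_component (d + Suc r) (Hypergraph V E) giant_component"
  unfolding giant_component_def
proof (rule tight_component_tight_class)
  show "set (SOME zs. rooted zs) \<in> E" by (rule rooted_edge [OF rooted_SOME])
  fix v assume v: "v \<in> V"
  have "d - 1 \<le> card (V - {v})" using v finite_V large by (simp add: card_Diff_singleton)
  then obtain R where R: "R \<subseteq> V - {v}" "card R = d - 1" "finite R" by (rule obtain_subset_with_card_n)
  have "v \<notin> R" using R(1) by blast
  then have S: "insert v R \<subseteq> V" "card (insert v R) = d" using R v d_pos by auto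
  obtain T where "T \<in> vicinity (insert v R)" using vicinity_nonempty [OF S] by blast
  then have "insert v R \<union> T \<in> giant_edges" by (rule vicinity_giant [OF S])
  then show "\<exists>e\<in>tight_class (d + Suc r) E (set (SOME zs. rooted zs)). v \<in> e"
    by (intro bexI [of _ "insert v R \<union> T"]) (auto simp: giant_component_def)
qed (use uniform in blast)

lemma giant_degree:
  assumes "S \<subseteq> V" "card S = d"
  shows "(card V + 1) ^ Suc r < 2 * card {xs \<in> tuples V (Suc r). S \<union> set xs \<in> giant_edges}"
proof -
  have "card (vicinity_tuples S) \<le> card {xs \<in> tuples V (Suc r). S \<union> set xs \<in> giant_edges}"
    using vicinity_giant [OF assms] by (intro card_mono) (auto simp: finite_tuples finite_V)
  then show ?thesis using vicinity_tuples_large [OF assms] by linarith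
qed

text \<open>A rotation is one step, and the way back from it consists of replacements, each of length \<open>k\<close>.\<close>

lemma giant_closed_walk: "\<exists>W m. closed_walk (d + Suc r) giant_component W m \<and> [m = 1] (mod (d + Suc r))"
proof -
  let ?k = "d + Suc r"
  let ?P = "ordered_edge ?k giant_edges"
  obtain zs where zs: "rooted zs" "rooted (rotate1 zs)" using exists_rooted_rotate by blast
  have P: "?P zs" "?P (rotate1 zs)" using rooted_giant [OF zs(1)] zs(1) by (auto simp: rooted_def)
  have "zs \<noteq> []" using P(1) by auto
  then have "rotate1 zs = tl zs @ [hd zs]" by (simp add: rotate1_hd_tl)
  then have rot: "(zs, rotate1 zs) \<in> slides ?P" using P unfolding slides_def by blast
  have "(rotate1 zs, zs) \<in> (moves ?P)\<^sup>*"
    using moves_tight_class [OF uniform_card rooted_connected [OF zs(2,1)]] P(2)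
    by (simp add: giant_component_def)
  then obtain m where m: "(rotate1 zs, zs) \<in> slides ?P ^^ (?k * m)"
    using moves_rtrancl_imp_slides by blast
  have "(zs, zs) \<in> moves ?P"
    unfolding moves_def using P(1) \<open>zs \<noteq> []\<close> list_update_id [of zs 0, symmetric] by blast
  \<comment> \<open>One idle round makes the walk at least as long as an edge.\<close>
  then have loop: "(zs, zs) \<in> slides ?P ^^ ?k" by (rule moves_imp_slides)
  have "(zs, zs) \<in> slides ?P ^^ ?k O (slides ?P ^^ 1 O slides ?P ^^ (?k * m))"
    by (intro relcompI [OF loop] relcompI [OF _ m]) (simp only: relpow_1 rot)
  then have "(zs, zs) \<in> slides ?P ^^ (?k + (1 + ?k * m))"
    by (simp only: relpow_add)
  then have "\<exists>W. closed_walk ?k giant_component W (?k + (1 + ?k * m))"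
    by (rule closed_walk_of_slides) (use giant_edges_subset uniform in auto)
  moreover have "[k + (1 + k * m) = 1] (mod k)" for k :: nat
  proof -
    have "k + (1 + k * m) = 1 + k * Suc m" by simp
    then show ?thesis unfolding Cong.cong_def by (simp only: mod_mult_self2)
  qed
  ultimately show ?thesis by blast
qed

text \<open>Let \<open>S\<close> consist of the \<open>d\<close> vertices of least weight and let \<open>a\<close> be the largest weight in \<open>S\<close>.
Lowering the weights outside \<open>S\<close> by \<open>a\<close> keeps them nonnegative, so the expansion property
of the giant edges in the link of \<open>S\<close> applies and bounds the sum from below. With \<open>k\<close> in place of
\<open>r + 2 \<le> k\<close> the shift by \<open>a\<close> cancels, and what remains is a multiple of \<open>d * a - sum x S \<ge> 0\<close>.\<close>

lemma giant_perfect_fractional_matching: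
  "\<exists>\<omega>. perfect_fractional_matching (d + Suc r) giant_component \<omega>"
proof (rule perfect_fractional_matchingI)
  show "finite (edges giant_component)"
    using giant_edges_subset uniform finite_V by (metis (no_types, lifting) PowI finite_Pow_iff finite_subset subset_iff)
  show "e \<subseteq> verts giant_component \<and> card e = d + Suc r" if "e \<in> giant_edges" for e
    using that giant_edges_subset uniform by auto
  fix x :: "'a \<Rightarrow> real" assume x: "\<And>e. e \<in> giant_edges \<Longrightarrow> 0 \<le> sum x e"
  obtain S where S: "S \<subseteq> V" "card S = d" and min: "\<forall>u\<in>S. \<forall>v\<in>V - S. x u \<le> x v"
    using exists_smallest_subset [OF finite_V, of d x] large by auto
  have finS: "finite S" using S(1) finite_V by (rule finite_subset)
  define a where "a = Max (x ` S)"
  have "x ` S \<noteq> {}" using S d_pos by auto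
  then have "a \<in> x ` S" unfolding a_def using finS by (intro Max_in) auto
  have a_max: "x u \<le> a" if "u \<in> S" for u using that finS by (simp add: a_def)
  have a_min: "a \<le> x v" if "v \<in> V - S" for v using that min \<open>a \<in> x ` S\<close> by auto
  define w where "w = (\<lambda>v. if v \<in> S then 0 else x v - a)"
  define n k where "n = real (card V)" and "k = real (d + Suc r)"
  have sumS: "sum x S \<le> d * a" using sum_bounded_above [of S x a] a_max S by simp
  have w0: "0 \<le> w v" if "v \<in> V" for v using a_min that by (simp add: w_def)
  have "(- sum x S - Suc r * a) * card V \<le> real (r + 2) * sum w V"
  proof (rule dense_uniform.giant_expansion [OF link_dense [OF S] w0])
    fix T assume "T \<in> dense_uniform.giant V (link S) r"
    then have T: "T \<in> vicinity S" unfolding vicinity_def .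
    note vT = vicinityD [OF S T]
    have finT: "finite T" using vT(1) finite_V by (rule finite_subset)
    have "0 \<le> sum x (S \<union> T)" using x vicinity_giant [OF S T] by simp
    also have "\<dots> = sum x S + sum x T" using vT(2) finS finT by (intro sum.union_disjoint) auto
    also have "sum x T = sum w T + Suc r * a"
    proof -
      have "sum w T = (\<Sum>v\<in>T. x v - a)" using vT(2) by (intro sum.cong) (auto simp: w_def)
      then show ?thesis using vT(3) by (simp add: sum_subtractf)
    qed
    finally show "- sum x S - Suc r * a \<le> sum w T" by simp
  qed
  \<comment> \<open>Passing from \<open>r + 2\<close> to \<open>k = d + r + 1\<close> uses \<open>d \<ge> 1\<close>.\<close>
  also have "\<dots> \<le> k * sum w V"
    using d_pos w0 by (intro mult_right_mono sum_nonneg) (auto simp: k_def)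
  finally have 1: "(- sum x S - Suc r * a) * n \<le> k * sum w V" unfolding n_def .
  have "sum w V = (\<Sum>v\<in>V - S. x v - a)"
    using finite_V S by (intro sum.mono_neutral_cong_right) (auto simp: w_def)
  also have "\<dots> = sum x (V - S) - (n - d) * a"
    using S finS card_mono [OF finite_V S(1)] by (simp add: sum_subtractf card_Diff_subset n_def of_nat_diff)
  also have "sum x (V - S) = sum x V - sum x S" using finite_V S by (simp add: sum_diff)
  finally have 2: "sum w V = sum x V - sum x S - (n - d) * a" .
  have "0 \<le> (n - k) * (d * a - sum x S)"
    using sumS large by (intro mult_nonneg_nonneg) (auto simp: n_def k_def)
  also have "\<dots> = (- sum x S - Suc r * a) * n + k * (sum x S + (n - d) * a)"
    by (simp add: k_def algebra_simps)
  also have "\<dots> \<le> k * sum x V" using 1 2 by (simp add: algebra_simps)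
  finally show "0 \<le> sum x (verts giant_component)"
    by (simp add: k_def zero_le_mult_iff)
qed (use finite_V in auto)

end

section \<open>Hamilton frameworks above the degree bound\<close>

lemma min_degree_le:
  assumes G: "kgraph k G" and S: "S \<subseteq> verts G" "card S = d"
  shows "min_degree d G \<le> card {e \<in> edges G. S \<subseteq> e}"
proof -
  let ?P = "\<lambda>m. \<forall>S. S \<subseteq> verts G \<and> card S = d \<longrightarrow> m \<le> card {e \<in> edges G. S \<subseteq> e}"
  have "?P (Greatest ?P)"
    by (rule GreatestI_nat [where k = 0 and b = "card {e \<in> edges G. S \<subseteq> e}"]) (use S in auto)
  then show ?thesis using S unfolding min_degree_def by blast
qed

lemma le_min_degree:
  assumes "\<And>S. S \<subseteq> verts G \<Longrightarrow> card S = d \<Longrightarrow> m \<le> card {e \<in> edges G. S \<subseteq> e}"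
    and "d \<le> card (verts G)"
  shows "m \<le> min_degree d G"
proof -
  obtain S where S: "S \<subseteq> verts G" "card S = d"
    using obtain_subset_with_card_n [OF assms(2)] by blast
  show ?thesis
    unfolding min_degree_def
    by (rule Greatest_le_nat [where b = "card {e \<in> edges G. S \<subseteq> e}"]) (use assms(1) S in auto)
qed

text \<open>Every edge over \<open>S\<close> gives one tuple for each ordering of its vertices outside \<open>S\<close>.\<close>

lemma card_extending_tuples:
  assumes finV: "finite V" and E: "\<And>e. e \<in> E \<Longrightarrow> e \<subseteq> V \<and> card e = d + t"
    and S: "S \<subseteq> V" "card S = d"
  shows "fact t * card {e \<in> E. S \<subseteq> e} \<le> card {xs \<in> tuples V t. S \<union> set xs \<in> E}"
proof -
  have finS: "finite S" using S(1) finV by (rule finite_subset)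
  have finE: "finite E" using E finV by (intro finite_subset [of E "Pow V"]) auto
  have cardD: "card (e - S) = t" if "e \<in> {e \<in> E. S \<subseteq> e}" for e
    using E [of e] that S finS by (simp add: card_Diff_subset)
  have "fact t * card {e \<in> E. S \<subseteq> e} = (\<Sum>e\<in>{e \<in> E. S \<subseteq> e}. fact t)" by simp
  also have "\<dots> = (\<Sum>e\<in>{e \<in> E. S \<subseteq> e}. card (permutations_of_set (e - S)))"
  proof (rule sum.cong [OF refl])
    fix e assume e: "e \<in> {e \<in> E. S \<subseteq> e}"
    then have "finite e" using E [of e] by (intro finite_subset [OF _ finV]) simp
    then have "finite (e - S)" by simp
    then show "fact t = card (permutations_of_set (e - S))" using cardD [OF e] by simp
  qed
  also have "\<dots> = card (\<Union>e\<in>{e \<in> E. S \<subseteq> e}. permutations_of_set (e - S))"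
  proof (rule card_UN_disjoint [symmetric])
    show "\<forall>e\<in>{e \<in> E. S \<subseteq> e}. \<forall>f\<in>{e \<in> E. S \<subseteq> e}. e \<noteq> f \<longrightarrow>
        permutations_of_set (e - S) \<inter> permutations_of_set (f - S) = {}"
      by (auto simp: permutations_of_set_def)
  qed (use finE in auto)
  also have "\<dots> \<le> card {xs \<in> tuples V t. S \<union> set xs \<in> E}"
  proof (rule card_mono)
    show "finite {xs \<in> tuples V t. S \<union> set xs \<in> E}" by (simp add: finite_tuples finV)
    show "(\<Union>e\<in>{e \<in> E. S \<subseteq> e}. permutations_of_set (e - S)) \<subseteq> {xs \<in> tuples V t. S \<union> set xs \<in> E}"
    proof safe
      fix e xs assume e: "e \<in> E" "S \<subseteq> e" and xs: "xs \<in> permutations_of_set (e - S)"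
      have set: "set xs = e - S" and dist: "distinct xs" using xs by (auto simp: permutations_of_set_def)
      have "length xs = t" using distinct_card [OF dist] set cardD [of e] e by simp
      then show "xs \<in> tuples V t" using set E [OF e(1)] by (auto simp: tuples_def)
      have "S \<union> set xs = e" using set e(2) by auto
      then show "S \<union> set xs \<in> E" using e(1) by simp
    qed
  qed
  finally show ?thesis .
qed

lemma power_le_fact_times_binomial: "(N - t) ^ t \<le> fact t * (N choose t)"
proof (induction t arbitrary: N)
  case 0
  show ?case by simp
next
  case (Suc t)
  show ?case
  proof (cases N)
    case 0
    then show ?thesis by simp
  next
    case (Suc M)
    have "(N - Suc t) ^ Suc t = (M - t) * (M - t) ^ t" using Suc by simp
    also have "\<dots> \<le> Suc M * (fact t * (M choose t))"
      by (intro mult_le_mono Suc.IH) simp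
    also have "\<dots> = fact t * (Suc M * (M choose t))" by (simp only: ac_simps)
    also have "\<dots> = fact (Suc t) * (N choose Suc t)"
      unfolding Suc_times_binomial_eq Suc fact_Suc by (simp only: ac_simps of_nat_id)
    finally show ?thesis .
  qed
qed

text \<open>The requirements on a single member of a framework, together with a degree condition that
forces two such components to overlap.\<close>

definition framework_component :: "nat \<Rightarrow> nat \<Rightarrow> 'a hypergraph \<Rightarrow> 'a hypergraph \<Rightarrow> bool" where
  "framework_component d t G H \<longleftrightarrow>
     subgraph H G \<and> verts H = verts G \<and> tight_component (d + t) G H \<and>
     (\<exists>\<omega>. perfect_fractional_matching (d + t) H \<omega>) \<and>
     (\<exists>W m. closed_walk (d + t) H W m \<and> [m = 1] (mod (d + t))) \<and>
     (\<forall>S\<subseteq>verts G. card S = d \<longrightarrow>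
        (card (verts G) + 1) ^ t < 2 * card {xs \<in> tuples (verts G) t. S \<union> set xs \<in> edges H})"

lemma dense_hypergraph_framework_component:
  assumes "dense_hypergraph (verts G) (edges G) d r"
  shows "\<exists>H. framework_component d (Suc r) G H"
proof -
  interpret dense_hypergraph "verts G" "edges G" d r by (rule assms)
  have "subgraph giant_component G"
    using giant_edges_subset uniform by (auto simp: subgraph_def)
  moreover have "tight_component (d + Suc r) G giant_component"
    using tight_component_giant by simp
  ultimately have "framework_component d (Suc r) G giant_component"
    unfolding framework_component_def
    using giant_perfect_fractional_matching giant_closed_walk giant_degree verts_giant_component
    by blast
  then show ?thesis by blast
qed

lemma tightly_connected_graph_union:
  assumes H: "tightly_connected k G H" and H': "tightly_connected k G' H'"
    and e: "e \<in> edges H" "e \<in> edges H'" and sub: "subgraph H J" "subgraph H' J"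
  shows "tightly_connected k J (graph_union H H')"
  unfolding tightly_connected_iff
proof (intro conjI ballI)
  show "subgraph (graph_union H H') J" using sub by (auto simp: subgraph_def graph_union_def)
  show "edges (graph_union H H') \<noteq> {}" using e by (auto simp: graph_union_def)
  show "\<exists>e\<in>edges (graph_union H H'). v \<in> e" if "v \<in> verts (graph_union H H')" for v
    using that H H' by (auto simp: tightly_connected_iff graph_union_def)
  have *: "(e, f) \<in> (tight_adj k (edges (graph_union H H')))\<^sup>*" if "f \<in> edges (graph_union H H')" for f
  proof -
    have "(e, f) \<in> (tight_adj k (edges H))\<^sup>* \<or> (e, f) \<in> (tight_adj k (edges H'))\<^sup>*"
      using that e H H' by (auto simp: tightly_connected_iff graph_union_def)
    then show ?thesis
      using tight_adj_rtrancl_mono [of "edges H" "edges (graph_union H H')"]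
        tight_adj_rtrancl_mono [of "edges H'" "edges (graph_union H H')"]
      by (auto simp: graph_union_def)
  qed
  show "(f, g) \<in> (tight_adj k (edges (graph_union H H')))\<^sup>*"
    if "f \<in> edges (graph_union H H')" "g \<in> edges (graph_union H H')" for f g
    using rtrancl_trans [OF tight_adj_rtrancl_sym [OF * [OF that(1)]] * [OF that(2)]] .
qed

text \<open>Choose \<open>S\<close> outside both deleted vertices. The tuples that extend \<open>S\<close> to edges of \<open>H\<close> and those
for \<open>H'\<close> are each more than half of the \<open>(s + 1) ^ t\<close> tuples over \<open>J\<close>, so some tuple
extends \<open>S\<close> to a common edge.\<close>

lemma framework_components_overlap:
  assumes J: "kgraph (d + t) J" "card (verts J) = s + 1" and xy: "x \<in> verts J" "y \<in> verts J" "x \<noteq> y"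
    and large: "d + t \<le> s" "0 < t"
    and H: "framework_component d t (delete_vertex J x) H"
    and H': "framework_component d t (delete_vertex J y) H'"
  shows "tightly_connected (d + t) J (graph_union H H')"
proof -
  have finJ: "finite (verts J)" using J by (simp add: kgraph_def)
  have verts: "verts (delete_vertex J z) = verts J - {z}" for z
    by (auto simp: delete_vertex_def induced_subgraph_def)
  have edges: "edges (delete_vertex J z) \<subseteq> edges J" for z
    by (auto simp: delete_vertex_def induced_subgraph_def)
  have cards: "card (verts (delete_vertex J z)) = s" if "z \<in> verts J" for z
    using that finJ J(2) by (simp add: verts card_Diff_singleton)
  have "card (verts J - {x, y}) = s - 1"
    using xy finJ J(2) by (simp add: card_Diff_subset)
  then have "d \<le> card (verts J - {x, y})" using large by simp
  then obtain S where S: "S \<subseteq> verts J - {x, y}" "card S = d" by (rule obtain_subset_with_card_n)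
  define A where "A = (\<lambda>z K. {xs \<in> tuples (verts (delete_vertex J z)) t. S \<union> set xs \<in> edges K})"
  have fin: "finite (tuples (verts J) t)" by (rule finite_tuples [OF finJ])
  have sub: "A z K \<subseteq> tuples (verts J) t" for z K by (auto simp: A_def tuples_def verts)
  have "(s + 1) ^ t < 2 * card (A z K)"
    if "framework_component d t (delete_vertex J z) K" "z \<in> {x, y}" for z K
  proof -
    have "S \<subseteq> verts (delete_vertex J z)" using S(1) that(2) by (auto simp: verts)
    then show ?thesis
      using that(1) S(2) cards [of z] that(2) xy unfolding framework_component_def A_def by auto
  qed
  from this [OF H] this [OF H'] have "(s + 1) ^ t < 2 * card (A x H)" "(s + 1) ^ t < 2 * card (A y H')"
    by simp_all
  moreover have "card (A x H) + card (A y H') \<le> (s + 1) ^ t" if "A x H \<inter> A y H' = {}"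
  proof -
    have "card (A x H) + card (A y H') = card (A x H \<union> A y H')"
      by (rule card_Un_disjoint [symmetric, OF finite_subset [OF sub fin] finite_subset [OF sub fin] that])
    also have "\<dots> \<le> card (tuples (verts J) t)" using sub by (intro card_mono fin) auto
    finally show ?thesis by (simp add: card_tuples finJ J(2))
  qed
  ultimately obtain xs where "xs \<in> A x H" "xs \<in> A y H'" by fastforce
  then have "S \<union> set xs \<in> edges H" "S \<union> set xs \<in> edges H'" by (auto simp: A_def)
  then show ?thesis
  proof (rule tightly_connected_graph_union [rotated 2])
    show "tightly_connected (d + t) (delete_vertex J x) H" "tightly_connected (d + t) (delete_vertex J y) H'"
      using H H' by (auto simp: framework_component_def tight_component_def)
    have "subgraph K J" if "framework_component d t (delete_vertex J z) K" for z K
    proof -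
      have "subgraph K (delete_vertex J z)" using that by (simp add: framework_component_def)
      then have K: "verts K \<subseteq> verts J - {z}" "edges K \<subseteq> edges (delete_vertex J z)"
        "\<forall>e\<in>edges K. e \<subseteq> verts K"
        by (simp_all add: subgraph_def verts)
      show ?thesis
        using subset_trans [OF K(1) Diff_subset] subset_trans [OF K(2) edges] K(3)
        by (simp add: subgraph_def)
    qed
    from this [OF H] this [OF H'] show "subgraph H J" "subgraph H' J" .
  qed
qed

lemma dense_family_admits_hamilton_framework:
  fixes \<G> :: "'a hypergraph set"
  assumes "\<And>G. G \<in> \<G> \<Longrightarrow> dense_hypergraph (verts G) (edges G) d r \<and> card (verts G) = n"
  shows "admits_hamilton_framework (d + Suc r) n \<G>"
proof -
  define F where "F = (\<lambda>G :: 'a hypergraph. SOME H. framework_component d (Suc r) G H)"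
  have F: "framework_component d (Suc r) G (F G)" if "G \<in> \<G>" for G
    unfolding F_def by (rule someI_ex, rule dense_hypergraph_framework_component) (use assms that in blast)
  have "hamilton_framework (d + Suc r) n \<G> F"
    unfolding hamilton_framework_def
  proof (intro conjI ballI allI impI)
    fix G assume G: "G \<in> \<G>"
    show "subgraph (F G) G" "card (verts (F G)) = n" "tight_component (d + Suc r) G (F G)"
      "\<exists>\<omega>. perfect_fractional_matching (d + Suc r) (F G) \<omega>"
      "\<exists>W m. closed_walk (d + Suc r) (F G) W m \<and> [m = 1] (mod (d + Suc r))"
      using F [OF G] assms [OF G] unfolding framework_component_def by simp_all
  next
    fix G G' J x y assume G: "G \<in> \<G>" and G': "G' \<in> \<G>"
      and J: "kgraph (d + Suc r) J \<and> card (verts J) = n + 1 \<and> x \<in> verts J \<and> y \<in> verts J \<and> x \<noteq> y \<and>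
        G = delete_vertex J x \<and> G' = delete_vertex J y"
    have "d + Suc r \<le> n" using assms [OF G] by (auto simp: dense_hypergraph_def)
    then show "tightly_connected (d + Suc r) J (graph_union (F G) (F G'))"
      using J F [OF G] F [OF G'] by (intro framework_components_overlap [where s = n and x = x and y = y]) auto
  qed
  then show ?thesis unfolding admits_hamilton_framework_def by blast
qed

lemma shifted_power_ratio_tendsto: "(\<lambda>n. ((real n + c) / real n) ^ t) \<longlonglongrightarrow> 1"
proof -
  have "(\<lambda>n. 1 + c / real n) \<longlonglongrightarrow> 1 + 0"
    by (intro tendsto_add tendsto_const lim_const_over_n)
  then have "(\<lambda>n. (1 + c / real n) ^ t) \<longlonglongrightarrow> (1 + 0) ^ t" by (rule tendsto_power)
  moreover have "\<forall>\<^sub>F n in sequentially. (1 + c / real n) ^ t = ((real n + c) / real n) ^ t"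
    using eventually_gt_at_top [of 0] by eventually_elim (simp add: field_simps)
  ultimately show ?thesis by (simp add: filterlim_cong [OF refl refl])
qed

text \<open>Divided by \<open>n ^ t\<close> the left-hand side tends to \<open>2 - 2 * t * \<epsilon>\<close>.\<close>

lemma eventually_degree_condition:
  fixes \<epsilon> :: real
  assumes t: "0 < t" and \<epsilon>: "0 < \<epsilon>"
  shows "\<forall>\<^sub>F n in sequentially.
    2 * real t * (real n ^ t - (1 - 1 / (2 * real t) + \<epsilon>) * real (n - k) ^ t) + (real n + 1) ^ t
      < 2 * real n ^ t"
proof -
  define \<alpha> where "\<alpha> = 1 - 1 / (2 * real t) + \<epsilon>"
  have "(\<lambda>n. 2 * real t * (1 - \<alpha> * ((real n + - real k) / real n) ^ t) + ((real n + 1) / real n) ^ t)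
      \<longlonglongrightarrow> 2 * real t * (1 - \<alpha> * 1) + 1"
    by (intro tendsto_intros shifted_power_ratio_tendsto)
  moreover have "2 * real t * (1 - \<alpha> * 1) + 1 < 2" using t \<epsilon> by (simp add: \<alpha>_def field_simps)
  ultimately have "\<forall>\<^sub>F n in sequentially.
      2 * real t * (1 - \<alpha> * ((real n + - real k) / real n) ^ t) + ((real n + 1) / real n) ^ t < 2"
    by (rule order_tendstoD(2))
  then show ?thesis
    using eventually_gt_at_top [of k]
    unfolding \<alpha>_def [symmetric]
  proof eventually_elim
    case (elim n)
    define N X Y where "N = real n ^ t" and "X = ((real n + - real k) / real n) ^ t"
      and "Y = ((real n + 1) / real n) ^ t"
    have N: "0 < N" using elim by (simp add: N_def)
    have 1: "real (n - k) ^ t = X * N"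
      using elim by (simp add: N_def X_def power_divide of_nat_diff)
    have 2: "(real n + 1) ^ t = Y * N"
      using elim by (simp add: N_def Y_def power_divide)
    have "(2 * real t * (1 - \<alpha> * X) + Y) * N < 2 * N"
      using elim(1) N unfolding X_def [symmetric] Y_def [symmetric] by (intro mult_strict_right_mono)
    then show ?case unfolding 1 2 N_def [symmetric] by (simp add: algebra_simps)
  qed
qed

lemma degree_family_dense:
  assumes d: "0 < d" and n: "d + Suc r \<le> n" and \<alpha>: "0 \<le> \<alpha>"
    and cond: "2 * real (Suc r) * (real n ^ Suc r - \<alpha> * real (n - (d + Suc r)) ^ Suc r) + (real n + 1) ^ Suc r
      < 2 * real n ^ Suc r"
    and G: "G \<in> degree_family d (d + Suc r) n \<alpha>"
  shows "dense_hypergraph (verts G) (edges G) d r"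
proof
  define t where "t = Suc r"
  have kG: "kgraph (d + t) G" and card: "card (verts G) = n"
    and deg: "\<alpha> * real ((n - d) choose t) \<le> real (min_degree d G)"
    using G by (auto simp: degree_family_def t_def)
  show fin: "finite (verts G)" using kG by (simp add: kgraph_def)
  show unif: "e \<subseteq> verts G \<and> card e = d + Suc r" if "e \<in> edges G" for e
    using kG that by (simp add: kgraph_def t_def)
  show "0 < d" by (rule d)
  show "d + Suc r \<le> card (verts G)" using n card by simp
  fix S assume S: "S \<subseteq> verts G" "card S = d"
  let ?in = "{xs \<in> tuples (verts G) t. S \<union> set xs \<in> edges G}"
  let ?out = "{xs \<in> tuples (verts G) t. S \<union> set xs \<notin> edges G}"
  have "card (tuples (verts G) t) = card ?in + card ?out"
  proof -
    have "card (?in \<union> ?out) = card ?in + card ?out"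
      by (rule card_Un_disjoint) (auto simp: finite_tuples fin)
    moreover have "?in \<union> ?out = tuples (verts G) t" by blast
    ultimately show ?thesis by simp
  qed
  then have split: "real (card ?in) + real (card ?out) = real n ^ t"
    using card by (simp add: card_tuples fin flip: of_nat_add of_nat_power)
  have "\<alpha> * real (n - (d + t)) ^ t \<le> \<alpha> * real (fact t * ((n - d) choose t))"
    using power_le_fact_times_binomial [of "n - d" t] \<alpha>
    by (intro mult_left_mono) (simp_all only: of_nat_power [symmetric] of_nat_le_iff diff_diff_left)
  also have "\<dots> \<le> fact t * real (min_degree d G)"
    using mult_left_mono [OF deg, of "fact t"] by (simp add: ac_simps)
  also have "\<dots> \<le> fact t * real (card {e \<in> edges G. S \<subseteq> e})"
    using min_degree_le [OF kG S] by (intro mult_left_mono) auto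
  also have "\<dots> = real (fact t * card {e \<in> edges G. S \<subseteq> e})" by simp
  also have "\<dots> \<le> real (card ?in)"
    using card_extending_tuples [OF fin _ S, of "edges G" t] unif
    by (simp only: of_nat_le_iff t_def)
  finally have "real (card ?out) \<le> real n ^ t - \<alpha> * real (n - (d + t)) ^ t" using split by simp
  then have "2 * real t * real (card ?out) \<le> 2 * real t * (real n ^ t - \<alpha> * real (n - (d + t)) ^ t)"
    by (intro mult_left_mono) auto
  then have "2 * real t * real (card ?out) + (real n + 1) ^ t < 2 * real n ^ t"
    using cond unfolding t_def by linarith
  then have "real (2 * t * card ?out + (n + 1) ^ t) < real (2 * n ^ t)" by (simp add: add.commute)
  then show "2 * Suc r * card {xs \<in> tuples (verts G) (Suc r). S \<union> set xs \<notin> edges G}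
      + (card (verts G) + 1) ^ Suc r < 2 * card (verts G) ^ Suc r"
    unfolding of_nat_less_iff t_def card .
qed

lemma hf_threshold_le:
  assumes d: "0 < d"
  shows "hf_threshold d (d + Suc r) \<le> 1 - 1 / (2 * real (Suc r))"
proof -
  define k where "k = d + Suc r"
  define \<delta> where "\<delta> = 1 - 1 / (2 * real (Suc r))"
  have \<delta>: "0 \<le> \<delta>" "\<delta> \<le> 1" by (simp_all add: \<delta>_def field_simps)
  have "\<exists>n0. \<forall>n\<ge>n0. admits_hamilton_framework k n (degree_family d k n (\<delta> + \<epsilon>))" if \<epsilon>: "0 < \<epsilon>" for \<epsilon>
  proof -
    have "\<forall>\<^sub>F n in sequentially. admits_hamilton_framework k n (degree_family d k n (\<delta> + \<epsilon>))"
      using eventually_degree_condition [OF zero_less_Suc \<epsilon>, of r k] eventually_ge_at_top [of k]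
    proof eventually_elim
      case (elim n)
      have "dense_hypergraph (verts G) (edges G) d r \<and> card (verts G) = n"
        if G: "G \<in> degree_family d (d + Suc r) n (\<delta> + \<epsilon>)" for G
      proof
        show "dense_hypergraph (verts G) (edges G) d r"
          by (rule degree_family_dense [OF d _ _ _ G])
            (use elim \<delta> \<epsilon> in \<open>simp_all only: k_def \<delta>_def [symmetric]\<close>)
        show "card (verts G) = n" using G by (simp add: degree_family_def)
      qed
      then show ?case unfolding k_def by (rule dense_family_admits_hamilton_framework)
    qed
    then show ?thesis by (simp add: eventually_sequentially)
  qed
  then show ?thesis
    unfolding hf_threshold_def k_def [symmetric] \<delta>_def [symmetric]
    using \<delta> by (intro cInf_lower bdd_belowI [where m = 0]) auto
qed

section \<open>Central binomial coefficients\<close>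

lemma central_binomial_Gamma:
  "real (2 * m choose m) / 4 ^ m = Gamma (real m + 1 / 2) / (sqrt pi * fact m)"
proof (induction m)
  case 0
  show ?case by (simp add: Gamma_one_half_real)
next
  case (Suc m)
  have choose: "real (2 * l choose l) = fact (2 * l) / (fact l * fact l)" for l
    using binomial_fact [of l "2 * l", where 'a = real] by simp
  have "real (2 * Suc m choose Suc m) = fact (2 * Suc m) / (fact (Suc m) * fact (Suc m))"
    by (rule choose)
  also have "\<dots> = (2 * real m + 2) * (2 * real m + 1) / (real m + 1) ^ 2 * (fact (2 * m) / (fact m * fact m))"
    by (simp add: power2_eq_square field_simps)
  also have "fact (2 * m) / (fact m * fact m) = real (2 * m choose m)"
    by (rule choose [symmetric])
  finally have "real (2 * Suc m choose Suc m) / 4 ^ Suc m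
      = (2 * real m + 2) * (2 * real m + 1) / (4 * (real m + 1) ^ 2) * (real (2 * m choose m) / 4 ^ m)"
    by (simp add: field_simps)
  also have "(2 * real m + 2) * (2 * real m + 1) / (4 * (real m + 1) ^ 2) = (real m + 1 / 2) / (real m + 1)"
    by (simp add: power2_eq_square divide_simps) (simp add: algebra_simps)
  also have "(real m + 1 / 2) / (real m + 1) * (real (2 * m choose m) / 4 ^ m)
      = (real m + 1 / 2) * Gamma (real m + 1 / 2) / (sqrt pi * ((real m + 1) * fact m))"
    unfolding Suc.IH by (simp add: field_simps)
  also have "(real m + 1 / 2) * Gamma (real m + 1 / 2) = Gamma (real (Suc m) + 1 / 2)"
  proof -
    have "real m + 1 / 2 \<notin> \<int>\<^sub>\<le>\<^sub>0"
      by (meson add_nonneg_pos half_gt_zero nonpos_Ints_nonpos not_le of_nat_0_le_iff zero_less_one)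
    then show ?thesis using Gamma_plus1 [of "real m + 1 / 2"] by (simp add: add.commute add.left_commute)
  qed
  finally show ?case by (simp add: add.commute)
qed

text \<open>Log-convexity at the midpoint of \<open>m\<close> and \<open>m + 1\<close>.\<close>

lemma Gamma_half_shift_le:
  assumes "0 < m"
  shows "Gamma (real m + 1 / 2) \<le> fact m / sqrt (real m)"
proof -
  define a b where "a = Gamma (real m)" and "b = Gamma (real m + 1)"
  have pos: "0 < a" "0 < b" "0 < Gamma (real m + 1 / 2)"
    unfolding a_def b_def using assms by (auto intro!: Gamma_real_pos)
  have "(ln \<circ> Gamma) ((1 - 1 / 2) *\<^sub>R real m + (1 / 2) *\<^sub>R (real m + 1))
      \<le> (1 - 1 / 2) * (ln \<circ> Gamma) (real m) + 1 / 2 * (ln \<circ> Gamma) (real m + 1)"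
    by (rule convex_onD [OF log_convex_Gamma_real]) (use assms in auto)
  moreover have "(1 - 1 / 2) *\<^sub>R real m + (1 / 2) *\<^sub>R (real m + 1) = real m + 1 / 2"
    by (simp add: field_simps)
  ultimately have "ln (Gamma (real m + 1 / 2)) \<le> 1 / 2 * (ln a + ln b)"
    by (simp add: a_def b_def)
  also have "\<dots> = ln (sqrt (a * b))" using pos by (simp add: ln_sqrt ln_mult)
  finally have "Gamma (real m + 1 / 2) \<le> sqrt (a * b)" using pos by simp
  also have "a = b / real m"
  proof -
    have "real m \<notin> \<int>\<^sub>\<le>\<^sub>0" using assms by (metis nonpos_Ints_nonpos not_le of_nat_0_less_iff)
    then show ?thesis using Gamma_plus1 [of "real m"] assms by (simp add: a_def b_def)
  qed
  also have "sqrt (b / real m * b) = b / sqrt (real m)"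
    using pos by (simp add: real_sqrt_divide real_sqrt_mult)
  also have "b = fact m" unfolding b_def by (metis Gamma_fact add.commute)
  finally show ?thesis .
qed

lemma central_binomial_le:
  assumes "0 < m"
  shows "real (2 * m choose m) \<le> 4 ^ m / sqrt (pi * real m)"
proof -
  have "real (2 * m choose m) / 4 ^ m \<le> (fact m / sqrt (real m)) / (sqrt pi * fact m)"
    unfolding central_binomial_Gamma
    by (intro divide_right_mono Gamma_half_shift_le assms) auto
  also have "\<dots> = 1 / sqrt (pi * real m)" by (simp add: real_sqrt_mult field_simps)
  finally show ?thesis by (simp add: field_simps)
qed

text \<open>The central coefficient is the largest. For odd \<open>t\<close> it is half of the central coefficient of the
next row, and the bound for that row is slightly stronger than needed.\<close>

lemma binomial_le_sqrt:
  assumes "0 < t"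
  shows "real (t choose m) \<le> 2 ^ t * sqrt (2 / (real t * pi))"
proof (cases "even t")
  case True
  then obtain l where l: "t = 2 * l" by (elim evenE)
  have "real (t choose m) \<le> real (t choose (t div 2))"
    by (simp add: binomial_maximum)
  also have "\<dots> \<le> 4 ^ l / sqrt (pi * real l)"
    using central_binomial_le [of l] assms l by simp
  also have "\<dots> = 2 ^ t * sqrt (2 / (real t * pi))"
  proof -
    have "(2 :: real) ^ t = 4 ^ l" using l by (simp add: power_mult)
    moreover have "2 / (real t * pi) = 1 / (pi * real l)" using l by (simp add: field_simps)
    ultimately show ?thesis by (simp add: real_sqrt_divide)
  qed
  finally show ?thesis .
next
  case False
  then obtain l where l: "t = 2 * l + 1" by (elim oddE)
  have "2 * (t choose l) = 2 * Suc l choose Suc l"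
    using l binomial_symmetric [of l "2 * l + 1"] by simp
  then have "2 * real (t choose l) = real (2 * Suc l choose Suc l)"
    by (metis of_nat_mult of_nat_numeral)
  also have "\<dots> \<le> 4 ^ Suc l / sqrt (pi * real (Suc l))" by (rule central_binomial_le) simp
  also have "\<dots> \<le> 4 ^ Suc l / sqrt (real t * pi / 2)"
  proof (intro divide_left_mono real_sqrt_le_mono)
    show "real t * pi / 2 \<le> pi * real (Suc l)" using l pi_gt_zero by (simp add: field_simps)
  qed (use assms in auto)
  also have "\<dots> = 2 * (2 ^ t * sqrt (2 / (real t * pi)))"
    using l by (simp add: power_mult real_sqrt_divide)
  finally have "real (t choose l) \<le> 2 ^ t * sqrt (2 / (real t * pi))" by simp
  moreover have "t choose m \<le> t choose l"
    using binomial_maximum [of t m] l by simp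
  ultimately show ?thesis by (meson of_nat_mono order_trans)
qed

section \<open>Hypergraphs without a Hamilton framework\<close>

lemma fact_fact_binomial_le:
  "fact m * fact l * ((h choose m) * (h choose l)) \<le> h ^ (m + l)"
proof -
  have "fact m * fact l * ((h choose m) * (h choose l)) = ((h choose m) * fact m) * ((h choose l) * fact l)"
    by (simp only: ac_simps)
  also have "\<dots> \<le> h ^ m * h ^ l" by (intro mult_le_mono binomial_fact_pow)
  finally show ?thesis by (simp add: power_add)
qed

text \<open>The construction of Han and Zhao, in which no edge meets \<open>X\<close> in exactly \<open>j\<close> vertices.\<close>

definition avoiding_hypergraph :: "nat \<Rightarrow> nat \<Rightarrow> 'a set \<Rightarrow> 'a set \<Rightarrow> 'a hypergraph" where
  "avoiding_hypergraph k j V X = Hypergraph V {e. e \<subseteq> V \<and> card e = k \<and> card (e \<inter> X) \<noteq> j}"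

text \<open>Outside \<open>S\<close> such a set consists of \<open>m\<close> vertices of \<open>X\<close> and \<open>t - m\<close> others, where \<open>m\<close> is
determined by \<open>S\<close>. The number of choices is at most \<open>(t choose m) * h ^ t / fact t\<close>.\<close>

lemma card_hit_exactly_le:
  assumes V: "finite V" "X \<subseteq> V" and h: "card X \<le> h" "card (V - X) \<le> h"
    and S: "S \<subseteq> V" "card S = d" and t: "0 < t"
  shows "real (fact t * card {e. S \<subseteq> e \<and> e \<subseteq> V \<and> card e = d + t \<and> card (e \<inter> X) = j})
     \<le> real (2 * h) ^ t * sqrt (2 / (real t * pi))"
proof -
  define Z where "Z = {e. S \<subseteq> e \<and> e \<subseteq> V \<and> card e = d + t \<and> card (e \<inter> X) = j}"
  define m where "m = j - card (S \<inter> X)"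
  have fin: "finite S" "finite X" using V S finite_subset by blast+
  have parts: "card (e \<inter> X - S) = m \<and> card (e - X - S) + m = t" if "e \<in> Z" for e
  proof -
    have e: "S \<subseteq> e" "e \<subseteq> V" "card e = d + t" "card (e \<inter> X) = j" using that by (auto simp: Z_def)
    have fine: "finite e" using e(2) V(1) by (rule finite_subset)
    have 1: "card (e \<inter> X) = card (e \<inter> X - S) + card (S \<inter> X)"
    proof -
      have "e \<inter> X = (e \<inter> X - S) \<union> (S \<inter> X)" using e(1) by blast
      then show ?thesis using fine fin card_Un_disjoint [of "e \<inter> X - S" "S \<inter> X"] by auto
    qed
    have "card (e - S) = t" using e S fin by (simp add: card_Diff_subset)
    moreover have "card (e - S) = card (e \<inter> X - S) + card (e - X - S)"
    proof -
      have "e - S = (e \<inter> X - S) \<union> (e - X - S)" by blast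
      then show ?thesis using fine card_Un_disjoint [of "e \<inter> X - S" "e - X - S"] by auto
    qed
    ultimately show ?thesis using 1 e(4) by (simp add: m_def)
  qed
  show ?thesis
  proof (cases "Z = {}")
    case True
    then show ?thesis unfolding Z_def [symmetric] by simp
  next
    case False
    then have mt: "m \<le> t" using parts by fastforce
    have "(\<lambda>e. (e \<inter> X - S, e - X - S)) ` Z \<subseteq>
        {A. A \<subseteq> X \<and> card A = m} \<times> {B. B \<subseteq> V - X \<and> card B = t - m}"
    proof (rule image_subsetI)
      fix e assume e: "e \<in> Z"
      then have "e \<subseteq> V" by (simp add: Z_def)
      then show "(e \<inter> X - S, e - X - S) \<in>
          {A. A \<subseteq> X \<and> card A = m} \<times> {B. B \<subseteq> V - X \<and> card B = t - m}"
        using parts [OF e] by auto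
    qed
    moreover have "finite ({A. A \<subseteq> X \<and> card A = m} \<times> {B. B \<subseteq> V - X \<and> card B = t - m})"
      using V fin by auto
    ultimately have "card ((\<lambda>e. (e \<inter> X - S, e - X - S)) ` Z) \<le>
        card ({A. A \<subseteq> X \<and> card A = m} \<times> {B. B \<subseteq> V - X \<and> card B = t - m})"
      by (rule card_mono [rotated])
    also have "\<dots> = (card X choose m) * (card (V - X) choose (t - m))"
      using V fin by (simp add: card_cartesian_product n_subsets)
    also have "\<dots> \<le> (h choose m) * (h choose (t - m))"
      using h by (intro mult_le_mono binomial_right_mono) auto
    also have "card ((\<lambda>e. (e \<inter> X - S, e - X - S)) ` Z) = card Z"
      by (rule card_image, rule inj_on_inverseI [where g = "\<lambda>(A, B). A \<union> B \<union> S"]) (auto simp: Z_def)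
    finally have "card Z \<le> (h choose m) * (h choose (t - m))" .
    then have "fact t * card Z \<le> (t choose m) * (fact m * fact (t - m) * ((h choose m) * (h choose (t - m))))"
      unfolding binomial_fact_lemma [OF mt, symmetric] by (simp add: ac_simps)
    also have "\<dots> \<le> (t choose m) * h ^ t"
      using fact_fact_binomial_le [of m "t - m" h] mt by (intro mult_le_mono2) simp
    finally have "real (fact t * card Z) \<le> real (t choose m) * real h ^ t"
      by (metis of_nat_le_iff of_nat_mult of_nat_power)
    also have "\<dots> \<le> (2 ^ t * sqrt (2 / (real t * pi))) * real h ^ t"
      by (intro mult_right_mono binomial_le_sqrt t) auto
    also have "\<dots> = real (2 * h) ^ t * sqrt (2 / (real t * pi))" by (simp add: power_mult_distrib)
    finally show ?thesis unfolding Z_def .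
  qed
qed

lemma card_between:
  assumes V: "finite V" and S: "S \<subseteq> V" "card S = d"
  shows "card {e. S \<subseteq> e \<and> e \<subseteq> V \<and> card e = d + t} = (card V - d) choose t"
proof -
  have finS: "finite S" using S(1) V by (rule finite_subset)
  have "bij_betw (\<lambda>e. e - S) {e. S \<subseteq> e \<and> e \<subseteq> V \<and> card e = d + t} {T. T \<subseteq> V - S \<and> card T = t}"
  proof (rule bij_betwI [where g = "\<lambda>T. T \<union> S"])
    show "(\<lambda>e. e - S) \<in> {e. S \<subseteq> e \<and> e \<subseteq> V \<and> card e = d + t} \<rightarrow> {T. T \<subseteq> V - S \<and> card T = t}"
      using S finS by (auto simp: card_Diff_subset)
    show "(\<lambda>T. T \<union> S) \<in> {T. T \<subseteq> V - S \<and> card T = t} \<rightarrow> {e. S \<subseteq> e \<and> e \<subseteq> V \<and> card e = d + t}"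
    proof
      fix T assume T: "T \<in> {T. T \<subseteq> V - S \<and> card T = t}"
      then have "finite T" using V finite_subset by blast
      moreover have "T \<inter> S = {}" using T by blast
      ultimately have "card (T \<union> S) = t + d" using T S finS by (simp add: card_Un_disjoint)
      then show "T \<union> S \<in> {e. S \<subseteq> e \<and> e \<subseteq> V \<and> card e = d + t}" using T S by auto
    qed
  qed auto
  then have "card {e. S \<subseteq> e \<and> e \<subseteq> V \<and> card e = d + t} = card {T. T \<subseteq> V - S \<and> card T = t}"
    by (rule bij_betw_same_card)
  also have "\<dots> = card (V - S) choose t" using V by (simp add: n_subsets)
  finally show ?thesis using S finS by (simp add: card_Diff_subset)
qed

lemma avoiding_hypergraph_degree_family:
  fixes V X :: "nat set"
  assumes V: "finite V" "X \<subseteq> V" and h: "card X = h" "card V = 2 * h"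
    and t: "0 < t" and large: "d + t \<le> 2 * h" and \<alpha>: "\<alpha> \<le> 1"
    and cond: "sqrt (2 / (real t * pi)) * real (2 * h) ^ t \<le> (1 - \<alpha>) * real (2 * h - (d + t)) ^ t"
  shows "avoiding_hypergraph (d + t) j V X \<in> degree_family d (d + t) (2 * h) \<alpha>"
proof -
  let ?G = "avoiding_hypergraph (d + t) j V X"
  define N where "N = (2 * h - d) choose t"
  have "real (2 * h - (d + t)) ^ t \<le> fact t * real N"
    using power_le_fact_times_binomial [of "2 * h - d" t] unfolding N_def diff_diff_left
    by (metis of_nat_fact of_nat_le_iff of_nat_mult of_nat_power)
  then have "(1 - \<alpha>) * real (2 * h - (d + t)) ^ t \<le> (1 - \<alpha>) * (fact t * real N)"
    using \<alpha> by (intro mult_left_mono) auto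
  with cond have N: "sqrt (2 / (real t * pi)) * real (2 * h) ^ t \<le> fact t * ((1 - \<alpha>) * real N)"
    by (simp add: ac_simps)
  have deg: "\<alpha> * real N \<le> real (card {e \<in> edges ?G. S \<subseteq> e})" if S: "S \<subseteq> V" "card S = d" for S
  proof -
    let ?all = "{e. S \<subseteq> e \<and> e \<subseteq> V \<and> card e = d + t}"
    let ?hit = "{e. S \<subseteq> e \<and> e \<subseteq> V \<and> card e = d + t \<and> card (e \<inter> X) = j}"
    have fin: "finite ?all" by (rule finite_subset [of _ "Pow V"]) (use V in auto)
    have "{e \<in> edges ?G. S \<subseteq> e} = ?all - ?hit" by (auto simp: avoiding_hypergraph_def)
    moreover have "?hit \<subseteq> ?all" by blast
    ultimately have "real (card {e \<in> edges ?G. S \<subseteq> e}) = real N - real (card ?hit)"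
      using fin card_between [OF V(1) S, of t] h card_mono [of ?all ?hit]
      by (simp add: card_Diff_subset finite_subset [of ?hit ?all] of_nat_diff N_def)
    moreover have "fact t * real (card ?hit) \<le> fact t * ((1 - \<alpha>) * real N)"
    proof -
      have "card (V - X) \<le> h" using V h by (simp add: card_Diff_subset finite_subset)
      then have "fact t * real (card ?hit) \<le> real (2 * h) ^ t * sqrt (2 / (real t * pi))"
        using card_hit_exactly_le [OF V _ _ S t, of h j] h by simp
      also have "\<dots> \<le> fact t * ((1 - \<alpha>) * real N)" using N by (simp add: mult.commute)
      finally show ?thesis .
    qed
    then have "real (card ?hit) \<le> (1 - \<alpha>) * real N" by simp
    ultimately show ?thesis by (simp add: algebra_simps)
  qed
  have "nat \<lceil>\<alpha> * real N\<rceil> \<le> min_degree d ?G"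
  proof (rule le_min_degree)
    show "nat \<lceil>\<alpha> * real N\<rceil> \<le> card {e \<in> edges ?G. S \<subseteq> e}"
      if "S \<subseteq> verts ?G" "card S = d" for S
      using deg [of S] that by (simp add: avoiding_hypergraph_def nat_le_iff ceiling_le_iff)
  qed (use h large in \<open>simp add: avoiding_hypergraph_def\<close>)
  then have "\<alpha> * real N \<le> real (min_degree d ?G)" by linarith
  then show ?thesis
    using V h by (auto simp: degree_family_def kgraph_def avoiding_hypergraph_def N_def)
qed

text \<open>Moving to an adjacent edge changes the size of the intersection with \<open>X\<close> by at most one, so it
cannot jump over \<open>j\<close>.\<close>

lemma avoiding_hypergraph_side:
  assumes V: "finite V" and H: "tightly_connected k (avoiding_hypergraph k j V X) H"
  shows "(\<forall>e\<in>edges H. card (e \<inter> X) < j) \<or> (\<forall>e\<in>edges H. j < card (e \<inter> X))"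
proof -
  let ?G = "avoiding_hypergraph k j V X"
  have E: "finite e" "card e = k" "card (e \<inter> X) \<noteq> j" if "e \<in> edges ?G" for e
    using that V finite_subset by (auto simp: avoiding_hypergraph_def)
  have sub: "edges H \<subseteq> edges ?G" using H by (simp add: tightly_connected_iff subgraph_def)
  have close: "card (f \<inter> X) \<le> Suc (card (e \<inter> X))" if "(e, f) \<in> tight_adj k (edges H)" for e f
  proof -
    have e: "e \<in> edges ?G" and f: "f \<in> edges ?G" and ef: "card (e \<inter> f) = k - 1"
      using that sub by (auto simp: tight_adj_def)
    have "card (f - e) = card f - card (e \<inter> f)"
      using E [OF f] by (simp add: card_Diff_subset_Int Int_commute)
    then have "card (f - e) \<le> 1" using E(2) [OF f] ef by simp
    moreover have "card (f \<inter> X) \<le> card ((e \<inter> X) \<union> (f - e))"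
      using E [OF e] E [OF f] by (intro card_mono) auto
    moreover have "card ((e \<inter> X) \<union> (f - e)) \<le> card (e \<inter> X) + card (f - e)" by (rule card_Un_le)
    ultimately show ?thesis by simp
  qed
  have side: "card (f \<inter> X) < j" if "(e, f) \<in> (tight_adj k (edges H))\<^sup>*" "card (e \<inter> X) < j" for e f
    using that
  proof (induction rule: rtrancl_induct)
    case (step f g)
    then have "g \<in> edges ?G" using sub by (auto simp: tight_adj_def)
    then show ?case using close [OF step(2)] step E(3) [of g] by simp
  qed
  have conn: "(e, f) \<in> (tight_adj k (edges H))\<^sup>*" if "e \<in> edges H" "f \<in> edges H" for e f
    using that H by (simp add: tightly_connected_iff)
  show ?thesis
  proof (cases "\<exists>e\<in>edges H. card (e \<inter> X) < j")
    case True
    then show ?thesis using side conn by blast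
  next
    case False
    then show ?thesis using E(3) sub by (meson linorder_neqE_nat subsetD)
  qed
qed

text \<open>The loads are at most \<open>1\<close> and sum to the number of vertices, so each of them equals \<open>1\<close>. Summing
them over \<open>X\<close> and interchanging the sums gives the identity.\<close>

lemma perfect_fractional_matching_average:
  assumes V: "finite (verts H)" and edge: "\<And>e. e \<in> edges H \<Longrightarrow> e \<subseteq> verts H \<and> card e = k"
    and k: "0 < k" and \<omega>: "perfect_fractional_matching k H \<omega>" and X: "X \<subseteq> verts H"
  shows "(\<Sum>e\<in>edges H. \<omega> e * card (e \<inter> X)) = card X"
proof -
  have finE: "finite (edges H)" using edge V by (intro finite_subset [of "edges H" "Pow (verts H)"]) auto
  define load where "load = (\<lambda>v. \<Sum>e\<in>{e \<in> edges H. v \<in> e}. \<omega> e)"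
  have count: "sum load Y = (\<Sum>e\<in>edges H. \<omega> e * card (e \<inter> Y))" if Y: "Y \<subseteq> verts H" for Y
  proof -
    have finY: "finite Y" using Y V by (rule finite_subset)
    have "sum load Y = (\<Sum>v\<in>Y. \<Sum>e\<in>edges H. if v \<in> e then \<omega> e else 0)"
      using finE by (simp add: load_def sum.inter_filter)
    also have "\<dots> = (\<Sum>e\<in>edges H. \<Sum>v\<in>Y. if v \<in> e then \<omega> e else 0)" by (rule sum.swap)
    also have "\<dots> = (\<Sum>e\<in>edges H. \<omega> e * card (e \<inter> Y))"
    proof (rule sum.cong [OF refl])
      fix e
      have "(\<Sum>v\<in>Y. if v \<in> e then \<omega> e else 0) = (\<Sum>v\<in>{v \<in> Y. v \<in> e}. \<omega> e)"
        by (rule sum.inter_filter [OF finY, symmetric])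
      also have "{v \<in> Y. v \<in> e} = e \<inter> Y" by blast
      finally show "(\<Sum>v\<in>Y. if v \<in> e then \<omega> e else 0) = \<omega> e * card (e \<inter> Y)" by simp
    qed
    finally show ?thesis .
  qed
  have "sum load (verts H) = (\<Sum>e\<in>edges H. \<omega> e * k)"
    unfolding count [OF subset_refl] using edge by (intro sum.cong) (auto simp: Int_absorb2)
  also have "\<dots> = card (verts H)"
    using \<omega> k by (simp add: perfect_fractional_matching_def sum_distrib_right [symmetric])
  finally have "(\<Sum>v\<in>verts H. 1 - load v) = 0" by (simp add: sum_subtractf)
  moreover have "0 \<le> 1 - load v" if "v \<in> verts H" for v
    using \<omega> that by (simp add: perfect_fractional_matching_def fractional_matching_def load_def)
  ultimately have "load v = 1" if "v \<in> verts H" for v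
    using V that by (simp add: sum_nonneg_eq_0_iff)
  then have "sum load X = card X" using X by (simp add: subset_iff)
  then show ?thesis using count [OF X] by simp
qed

text \<open>In a perfect fractional matching the sizes \<open>card (e \<inter> X)\<close> average to \<open>k / 2\<close>, whereas
within one tight component they are all at most \<open>k / 2 - 1\<close> or all at least \<open>(k + 1) / 2\<close>.\<close>

lemma avoiding_hypergraph_no_framework:
  assumes V: "finite V" "X \<subseteq> V" and h: "card X = h" "card V = 2 * h" "0 < h" and k: "2 \<le> k"
    and G: "avoiding_hypergraph k (k div 2) V X \<in> \<G>"
  shows "\<not> admits_hamilton_framework k (2 * h) \<G>"
proof
  let ?G = "avoiding_hypergraph k (k div 2) V X"
  assume "admits_hamilton_framework k (2 * h) \<G>"
  then obtain F where F: "hamilton_framework k (2 * h) \<G> F" unfolding admits_hamilton_framework_def by blast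
  obtain H \<omega> where sub: "subgraph H ?G" and cardH: "card (verts H) = 2 * h"
    and H: "tightly_connected k ?G H" and \<omega>: "perfect_fractional_matching k H \<omega>"
    using F [unfolded hamilton_framework_def, THEN conjunct1, THEN bspec, OF G]
    unfolding tight_component_def by metis
  have "verts H \<subseteq> V" using sub by (simp add: subgraph_def avoiding_hypergraph_def)
  then have vH: "verts H = V" using V cardH h by (intro card_subset_eq) auto
  have edge: "e \<subseteq> verts H \<and> card e = k" if "e \<in> edges H" for e
    using sub that unfolding vH by (auto simp: subgraph_def avoiding_hypergraph_def)
  have \<omega>0: "0 \<le> \<omega> e" if "e \<in> edges H" for e
    using \<omega> that by (simp add: perfect_fractional_matching_def fractional_matching_def)
  have total: "(\<Sum>e\<in>edges H. \<omega> e) * k = 2 * real h"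
    using \<omega> cardH k by (simp add: perfect_fractional_matching_def)
  have avg: "(\<Sum>e\<in>edges H. \<omega> e * card (e \<inter> X)) = h"
    using perfect_fractional_matching_average [OF _ edge _ \<omega>, of X] vH V h k by simp
  from avoiding_hypergraph_side [OF V(1) H] show False
  proof
    assume low: "\<forall>e\<in>edges H. card (e \<inter> X) < k div 2"
    have "(\<Sum>e\<in>edges H. \<omega> e * card (e \<inter> X)) \<le> (\<Sum>e\<in>edges H. \<omega> e * (real k / 2 - 1))"
    proof (intro sum_mono mult_left_mono \<omega>0)
      fix e assume "e \<in> edges H"
      then have "2 * Suc (card (e \<inter> X)) \<le> k" using low by fastforce
      then have "real (2 * Suc (card (e \<inter> X))) \<le> real k" by (simp only: of_nat_le_iff)
      then show "real (card (e \<inter> X)) \<le> real k / 2 - 1" by simp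
    qed
    also have "\<dots> = (\<Sum>e\<in>edges H. \<omega> e) * k / 2 - (\<Sum>e\<in>edges H. \<omega> e)"
      unfolding sum_distrib_right [symmetric] by (simp add: right_diff_distrib)
    finally have "(\<Sum>e\<in>edges H. \<omega> e) \<le> 0" using avg total by simp
    then have "(\<Sum>e\<in>edges H. \<omega> e) * k \<le> 0" by (simp add: mult_nonpos_nonneg)
    then show False using total h by simp
  next
    assume high: "\<forall>e\<in>edges H. k div 2 < card (e \<inter> X)"
    have "(\<Sum>e\<in>edges H. \<omega> e * (real k / 2 + 1 / 2)) \<le> (\<Sum>e\<in>edges H. \<omega> e * card (e \<inter> X))"
    proof (intro sum_mono mult_left_mono \<omega>0)
      fix e assume "e \<in> edges H"
      then have "k + 1 \<le> 2 * card (e \<inter> X)" using high by fastforce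
      then have "real (k + 1) \<le> real (2 * card (e \<inter> X))" by (simp only: of_nat_le_iff)
      then show "real k / 2 + 1 / 2 \<le> real (card (e \<inter> X))" by simp
    qed
    moreover have "(\<Sum>e\<in>edges H. \<omega> e * (real k / 2 + 1 / 2))
        = (\<Sum>e\<in>edges H. \<omega> e) * k / 2 + (\<Sum>e\<in>edges H. \<omega> e) / 2"
      unfolding sum_distrib_right [symmetric] by (simp add: distrib_left)
    ultimately have "(\<Sum>e\<in>edges H. \<omega> e) \<le> 0" using avg total by simp
    then have "(\<Sum>e\<in>edges H. \<omega> e) * k \<le> 0" by (simp add: mult_nonpos_nonneg)
    then show False using total h by simp
  qed
qed

lemma eventually_shifted_power_ge:
  fixes c :: real
  assumes c: "0 \<le> c" and \<epsilon>: "0 < \<epsilon>"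
  shows "\<forall>\<^sub>F n in sequentially. c * real n ^ t \<le> (c + \<epsilon>) * real (n - k) ^ t"
proof -
  have "(\<lambda>n. (c + \<epsilon>) * ((real n + - real k) / real n) ^ t) \<longlonglongrightarrow> (c + \<epsilon>) * 1"
    by (intro tendsto_intros shifted_power_ratio_tendsto)
  then have "\<forall>\<^sub>F n in sequentially. c < (c + \<epsilon>) * ((real n + - real k) / real n) ^ t"
    by (rule order_tendstoD) (use \<epsilon> in simp)
  then show ?thesis
    using eventually_gt_at_top [of k]
  proof eventually_elim
    case (elim n)
    have eq: "real (n - k) ^ t = ((real n + - real k) / real n) ^ t * real n ^ t"
      using elim by (simp add: power_divide of_nat_diff)
    have "c * real n ^ t \<le> ((c + \<epsilon>) * ((real n + - real k) / real n) ^ t) * real n ^ t"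
      using elim by (intro mult_right_mono) auto
    then show ?case unfolding eq by (simp only: mult.assoc)
  qed
qed

lemma no_framework_below:
  assumes t: "0 < t" and d: "0 < d" and \<alpha>: "\<alpha> < 1 - sqrt (2 / (real t * pi))"
  shows "\<exists>n\<ge>n0. \<not> admits_hamilton_framework (d + t) n (degree_family d (d + t) n \<alpha>)"
proof -
  define c where "c = sqrt (2 / (real t * pi))"
  have c: "0 \<le> c" using t by (simp add: c_def)
  have \<epsilon>: "0 < 1 - \<alpha> - c" using \<alpha> by (simp add: c_def)
  obtain n1 where n1: "\<And>n. n1 \<le> n \<Longrightarrow> c * real n ^ t \<le> (c + (1 - \<alpha> - c)) * real (n - (d + t)) ^ t"
    using eventually_shifted_power_ge [OF c \<epsilon>, of t "d + t"] by (auto simp: eventually_sequentially)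
  define h where "h = n0 + n1 + d + t"
  have "avoiding_hypergraph (d + t) ((d + t) div 2) {..<2 * h} {..<h} \<in> degree_family d (d + t) (2 * h) \<alpha>"
  proof (rule avoiding_hypergraph_degree_family)
    show "sqrt (2 / (real t * pi)) * real (2 * h) ^ t \<le> (1 - \<alpha>) * real (2 * h - (d + t)) ^ t"
      using n1 [of "2 * h"] by (simp add: h_def c_def)
  qed (use t c \<epsilon> in \<open>auto simp: h_def\<close>)
  then have "\<not> admits_hamilton_framework (d + t) (2 * h) (degree_family d (d + t) (2 * h) \<alpha>)"
    by (rule avoiding_hypergraph_no_framework [rotated -1]) (use t d in \<open>auto simp: h_def\<close>)
  then show ?thesis by (intro exI [of _ "2 * h"]) (simp add: h_def)
qed

lemma degree_family_above_one:
  assumes "k \<le> n" and "d \<le> k" and "1 < \<alpha>"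
  shows "degree_family d k n \<alpha> = {}"
proof (rule ccontr)
  assume "degree_family d k n \<alpha> \<noteq> {}"
  then obtain G where "G \<in> degree_family d k n \<alpha>" by blast
  then have G: "kgraph k G" "card (verts G) = n"
    and deg: "\<alpha> * real ((n - d) choose (k - d)) \<le> real (min_degree d G)"
    by (simp_all add: degree_family_def)
  have fin: "finite (verts G)" using G(1) by (simp add: kgraph_def)
  obtain S where S: "S \<subseteq> verts G" "card S = d"
    using obtain_subset_with_card_n [of d "verts G"] assms G(2) by auto
  let ?all = "{e. S \<subseteq> e \<and> e \<subseteq> verts G \<and> card e = d + (k - d)}"
  have "{e \<in> edges G. S \<subseteq> e} \<subseteq> ?all" using G(1) assms by (auto simp: kgraph_def)
  moreover have "finite ?all" by (rule finite_subset [of _ "Pow (verts G)"]) (use fin in auto)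
  ultimately have "card {e \<in> edges G. S \<subseteq> e} \<le> card ?all" by (rule card_mono [rotated])
  then have "min_degree d G \<le> (n - d) choose (k - d)"
    using min_degree_le [OF G(1) S] card_between [OF fin S, of "k - d"] G(2) by simp
  then have "\<alpha> * real ((n - d) choose (k - d)) \<le> 1 * real ((n - d) choose (k - d))"
    using deg by linarith
  moreover have "0 < real ((n - d) choose (k - d))" using assms by simp
  ultimately show False using assms(3) by (simp add: mult_le_cancel_right)
qed

text \<open>The lower bounds proved for single values of \<open>\<delta>\<close> pass to the infimum because the set is nonempty:
above relative degree \<open>1\<close> the families are empty, so \<open>\<delta> = 1\<close> qualifies.\<close>

lemma hf_threshold_ge:
  assumes t: "0 < t" and d: "0 < d"
  shows "1 - sqrt (2 / (real t * pi)) \<le> hf_threshold d (d + t)"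
  unfolding hf_threshold_def
proof (rule cInf_greatest)
  let ?D = "{\<delta>. 0 \<le> \<delta> \<and> \<delta> \<le> 1 \<and> (\<forall>\<epsilon>>0. \<exists>n0. \<forall>n\<ge>n0.
    admits_hamilton_framework (d + t) n (degree_family d (d + t) n (\<delta> + \<epsilon>)))}"
  have "admits_hamilton_framework (d + t) n (degree_family d (d + t) n (1 + \<epsilon>))"
    if "0 < \<epsilon>" "d + t \<le> n" for n and \<epsilon> :: real
    using degree_family_above_one [of "d + t" n d "1 + \<epsilon>"] that
    by (simp add: admits_hamilton_framework_def hamilton_framework_def)
  then have "1 \<in> ?D" by auto
  then show "?D \<noteq> {}" by blast
  fix \<delta> assume \<delta>: "\<delta> \<in> ?D"
  show "1 - sqrt (2 / (real t * pi)) \<le> \<delta>"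
  proof (rule field_le_epsilon)
    fix \<epsilon> :: real assume "0 < \<epsilon>"
    then obtain n0 where
      "\<forall>n\<ge>n0. admits_hamilton_framework (d + t) n (degree_family d (d + t) n (\<delta> + \<epsilon>))"
      using \<delta> by blast
    then show "1 - sqrt (2 / (real t * pi)) \<le> \<delta> + \<epsilon>"
      using no_framework_below [OF t d, of "\<delta> + \<epsilon>" n0] by (meson not_le)
  qed
qed

section \<open>The two bounds\<close>

theorem theorem2p9:
  fixes d k :: nat
  assumes "1 \<le> d" and "d < k"
  shows "1 - sqrt (2 / (real (k - d) * pi)) \<le> hf_threshold d k
       \<and> hf_threshold d k \<le> 1 - 1 / (2 * real (k - d))"
proof -
  obtain r where k: "k = d + Suc r" using assms(2) by (metis less_iff_Suc_add add_Suc_right)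
  show ?thesis
    using hf_threshold_ge [of "Suc r" d] hf_threshold_le [of d r] assms(1) by (simp add: k)
qed

end
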